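(* Let $n\ge 0$ and $p\geq 1$ be integers and let $\ell_0,\dots,\ell_n$ be integers each coprime with $p$. Consider the free $\mathbb{Z}_p$-action on the unit sphere $S^{2n+1}\subset\mathbb{C}^{n+1}$ generated by $$\psi(z_0,\dots,z_n)=\left(e^{2\pi\sqrt{-1}\,\ell_0/p}z_0,\;e^{2\pi\sqrt{-1}\,\ell_1/p}z_1,\;\dots,\;e^{2\pi\sqrt{-1}\,\ell_n/p}z_n\right).$$ Let $\alpha$ be any contact form on the standard contact sphere $S^{2n+1}$ that is invariant under this action, i.e. $\psi^*\alpha=\alpha$. Then the Reeb flow of $\alpha$ has at least one symmetric closed orbit, i.e. a periodic Reeb orbit $\gamma$ such that $g(\mathrm{Im}(\gamma))=\mathrm{Im}(\gamma)$ for every $g\in\mathbb{Z}_p$.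
   Context: Identify $\mathbb{R}^{2n+2}$ with $\mathbb{C}^{n+1}$ in the usual way and let $\lambda=\frac12\sum_{i=1}^{n+1}(q_i\,dp_i-p_i\,dq_i)$ be the Liouville form. The standard contact structure on $S^{2n+1}=\{v\in\mathbb{R}^{2n+2}:\|v\|=1\}$ is $\xi=\ker\lambda|_{S^{2n+1}}$. A contact form on the standard contact sphere (supporting this cooriented contact structure) is a 1-form $\alpha=f\lambda|_{S^{2n+1}}$ with $f:S^{2n+1}\to\mathbb{R}$ a positive smooth function. Its Reeb vector field $R_\alpha$ is uniquely determined by $\iota_{R_\alpha}d\alpha=0$ and $\alpha(R_\alpha)=1$; closed (periodic) Reeb orbits are periodic orbits of the flow of $R_\alpha$. *)

theory Defs
  imports "HOL-Analysis.Analysis"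
begin

text \<open>
  The space \<open>complex ^ 'n\<close> with \<open>CARD('n) = n + 1\<close> is \<open>\<complex>\<^sup>n\<^sup>+\<^sup>1\<close>, identified with \<open>\<real>\<^sup>2\<^sup>n\<^sup>+\<^sup>2\<close>
  through \<open>z\<^sub>i = q\<^sub>i + \<i> p\<^sub>i\<close>.  Its inner product and norm in the library are the real Euclidean ones.
\<close>

abbreviation unit_sphere :: "(complex ^ 'n::finite) set" where
  "unit_sphere \<equiv> sphere 0 1"

definition sphere_tangent :: "complex ^ 'n::finite \<Rightarrow> (complex ^ 'n) set" where
  "sphere_tangent x = {v. x \<bullet> v = 0}"

definition tangent_proj :: "complex ^ 'n::finite \<Rightarrow> complex ^ 'n \<Rightarrow> complex ^ 'n" where
  "tangent_proj x v = v - (x \<bullet> v) *\<^sub>R x"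

text \<open>\<open>C\<^sup>k\<close> regularity; meaningful for open \<open>U\<close>.\<close>

primrec Ck_on :: "nat \<Rightarrow> ('a::euclidean_space \<Rightarrow> real) \<Rightarrow> 'a set \<Rightarrow> bool" where
  "Ck_on 0 f U \<longleftrightarrow> continuous_on U f"
| "Ck_on (Suc k) f U \<longleftrightarrow>
     (\<forall>x\<in>U. f differentiable (at x)) \<and> (\<forall>v. Ck_on k (\<lambda>x. frechet_derivative f (at x) v) U)"

text \<open>
  Smoothness of a function on an arbitrary subset of Euclidean space: locally the restriction of a
  smooth function on an open set.  Values of \<open>f\<close> outside \<open>S\<close> play no role.
\<close>

definition smooth_on_subset :: "('a::euclidean_space \<Rightarrow> real) \<Rightarrow> 'a set \<Rightarrow> bool" where
  "smooth_on_subset f S \<longleftrightarrow>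
     (\<forall>x\<in>S. \<exists>U F. open U \<and> x \<in> U \<and> (\<forall>k. Ck_on k F U) \<and> (\<forall>y\<in>U \<inter> S. F y = f y))"

definition liouville :: "complex ^ 'n::finite \<Rightarrow> complex ^ 'n \<Rightarrow> real" where
  "liouville z v = (1 / 2) * (\<Sum>i\<in>UNIV. Re (z $ i) * Im (v $ i) - Im (z $ i) * Re (v $ i))"

text \<open>
  A 1-form on the sphere is represented by a function \<open>\<alpha>\<close> of a base point and a vector; only the
  values \<open>\<alpha> x v\<close> with \<open>x\<close> on the sphere and \<open>v\<close> tangent at \<open>x\<close> are relevant.
\<close>

definition contact_form_sphere :: "(complex ^ 'n::finite \<Rightarrow> complex ^ 'n \<Rightarrow> real) \<Rightarrow> bool" where
  "contact_form_sphere \<alpha> \<longleftrightarrow>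
     (\<exists>f. smooth_on_subset f unit_sphere \<and> (\<forall>x\<in>unit_sphere. f x > 0) \<and>
          (\<forall>x\<in>unit_sphere. \<forall>v\<in>sphere_tangent x. \<alpha> x v = f x * liouville x v))"

text \<open>
  Exterior derivative on the sphere.  The form is first extended to all vectors \<open>v\<close> by
  \<open>\<beta>\<^sub>y(v) = \<alpha>\<^sub>y(P\<^sub>y v)\<close>, where \<open>P\<^sub>y\<close> is the orthogonal projection onto the tangent space at \<open>y\<close>; then
  \<open>d\<alpha>(u,v) = D\<^sub>u(\<beta>(v)) - D\<^sub>v(\<beta>(u))\<close> with \<open>u\<close>, \<open>v\<close> constant.  This is the restriction to the sphere of the
  Euclidean exterior derivative of any smooth extension of \<open>\<beta>\<close>.  The arguments \<open>u\<close>, \<open>v\<close> must be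
  tangent at \<open>x\<close>: a derivative within the sphere is determined only in tangent directions.
\<close>

definition sphere_ext_deriv ::
  "(complex ^ 'n::finite \<Rightarrow> complex ^ 'n \<Rightarrow> real) \<Rightarrow> complex ^ 'n \<Rightarrow> complex ^ 'n \<Rightarrow> complex ^ 'n \<Rightarrow> real" where
  "sphere_ext_deriv \<alpha> x u v =
     frechet_derivative (\<lambda>y. \<alpha> y (tangent_proj y v)) (at x within unit_sphere) u
   - frechet_derivative (\<lambda>y. \<alpha> y (tangent_proj y u)) (at x within unit_sphere) v"

definition reeb_field :: "(complex ^ 'n::finite \<Rightarrow> complex ^ 'n \<Rightarrow> real) \<Rightarrow> complex ^ 'n \<Rightarrow> complex ^ 'n" where
  "reeb_field \<alpha> x =
     (THE w. w \<in> sphere_tangent x \<and> \<alpha> x w = 1 \<and> (\<forall>v\<in>sphere_tangent x. sphere_ext_deriv \<alpha> x w v = 0))"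

definition closed_reeb_orbit ::
  "(complex ^ 'n::finite \<Rightarrow> complex ^ 'n \<Rightarrow> real) \<Rightarrow> (real \<Rightarrow> complex ^ 'n) \<Rightarrow> bool" where
  "closed_reeb_orbit \<alpha> \<gamma> \<longleftrightarrow>
     (\<forall>t. \<gamma> t \<in> unit_sphere \<and> (\<gamma> has_vector_derivative reeb_field \<alpha> (\<gamma> t)) (at t)) \<and>
     (\<exists>T>0. \<forall>t. \<gamma> (t + T) = \<gamma> t)"

definition pullback_form ::
  "('a::euclidean_space \<Rightarrow> 'a) \<Rightarrow> ('a \<Rightarrow> 'a \<Rightarrow> real) \<Rightarrow> 'a \<Rightarrow> 'a \<Rightarrow> real" where
  "pullback_form \<phi> \<alpha> x v = \<alpha> (\<phi> x) (frechet_derivative \<phi> (at x) v)"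

definition lens_rotation :: "nat \<Rightarrow> ('n::finite \<Rightarrow> int) \<Rightarrow> complex ^ 'n \<Rightarrow> complex ^ 'n" where
  "lens_rotation p l z = (\<chi> i. exp (2 * of_real pi * \<i> * of_int (l i) / of_nat p) * z $ i)"

definition lens_group :: "nat \<Rightarrow> ('n::finite \<Rightarrow> int) \<Rightarrow> (complex ^ 'n \<Rightarrow> complex ^ 'n) set" where
  "lens_group p l = {lens_rotation p l ^^ k | k. k < p}"

end

theory Submission
  imports Defs "HOL-Homology.Homology" "HOL-Complex_Analysis.Great_Picard"
begin

text \<open>
  Put \<open>H z = |z|\<^sup>2 / f (z / |z|)\<close>. Radial projection turns the flow of \<open>\<i> \<nabla>H\<close> into the Reeb flow of
  \<open>f \<lambda>\<close>, so it suffices to solve \<open>x' = \<tau> \<i> \<nabla>H(x)\<close>, \<open>x 1 = \<psi> (x 0)\<close> with \<open>\<tau> > 0\<close> and \<open>x \<noteq> 0\<close>: the Reeb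
  orbit through \<open>x 0\<close> then satisfies \<open>\<gamma> (t + \<tau>) = \<psi> (\<gamma> t)\<close>, hence is closed and symmetric. Such \<open>x\<close> are the
  critical points, with value \<open>\<tau>\<close>, of the quotient of the action by \<open>\<integral> H(x)\<close> on paths twisted by \<open>\<psi>\<close>.

  On the span of finitely many twisted Fourier modes a critical point is found by linking: a half
  sphere spanned by the modes of nonpositive frequency and one mode of positive frequency cannot be
  pushed off the modes of positive frequency while its equator stays fixed. This bounds the critical
  value from both sides by positive constants that do not depend on the number of modes. The critical
  points are then bounded in \<open>H\<^sup>1\<close>, and the theorem of Arzela and Ascoli gives a limit, which is a
  solution because the Fourier modes are complete.
\<close>

section \<open>Linking on spheres in coordinate spaces\<close>

text \<open>The action is strongly indefinite: on all twisted paths its positive and its negative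
  directions are both infinite-dimensional, so neither minimisation nor a linking argument resting
  on the topology of finite-dimensional spheres applies directly. Hence the cutoff to finitely many
  modes, and hence the care that every constant be fixed before the cutoff. The lower bound for the
  critical value comes from a gap below the positive frequencies, here multiples of 2 pi / p; it
  keeps \<tau> positive in the limit. The upper bound comes from one positive mode kept for all
  cutoffs. Dividing by the integral of \<open>H\<close> makes the functional homogeneous of degree
  0, so critical points on the coefficient sphere are free critical points and the multiplier is the
  critical value. The gradient of \<open>H\<close> is only assumed continuous in the variational
  part. Deformations are therefore iterated explicit steps, not a gradient flow, and the solution is
  continued past one period by gluing rotated copies, not by a theorem on existence and uniqueness
  for differential equations.\<close>

definition coord_sphere :: "'i set \<Rightarrow> ('i \<Rightarrow> real) set" where
  "coord_sphere I = {c. (\<forall>i. i \<notin> I \<longrightarrow> c i = 0) \<and> (\<Sum>i\<in>I. (c i)\<^sup>2) = 1}"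

definition upper_half_sphere :: "'i set \<Rightarrow> 'i \<Rightarrow> ('i \<Rightarrow> real) set" where
  "upper_half_sphere K e = {c \<in> coord_sphere (insert e K). 0 \<le> c e}"

text \<open>The index set is a finite subset of a type and changes with the cutoff, so coefficient
  vectors are functions under the product topology. Compactness comes from Tychonoff for the box
  with sides [-1,1] on \<open>I\<close> and {0} elsewhere, not from Heine-Borel.\<close>

lemma compact_coord_sphere:
  assumes "finite I"
  shows "compact (coord_sphere I)"
proof -
  let ?B = "PiE UNIV (\<lambda>i. if i \<in> I then {-1..1} else {0}) :: ('a \<Rightarrow> real) set"
  have "compactin (product_topology (\<lambda>i. euclidean) UNIV) ?B"
    by (subst compactin_PiE) (auto simp: compactin_euclidean_iff)
  then have cB: "compact ?B"
    by (simp add: euclidean_product_topology compactin_euclidean_iff)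
  have cl: "closed {c::'a \<Rightarrow> real. (\<Sum>i\<in>I. (c i)\<^sup>2) = 1}"
    by (intro closed_Collect_eq continuous_intros continuous_on_product_coordinates)
  have "coord_sphere I = ?B \<inter> {c. (\<Sum>i\<in>I. (c i)\<^sup>2) = 1}"
  proof (intro equalityI subsetI)
    fix c :: "'a \<Rightarrow> real" assume c: "c \<in> coord_sphere I"
    have "\<bar>c i\<bar> \<le> 1" if "i \<in> I" for i
    proof -
      have "(c i)\<^sup>2 \<le> (\<Sum>i\<in>I. (c i)\<^sup>2)"
        using that assms by (intro member_le_sum) auto
      then show ?thesis
        using c by (simp add: coord_sphere_def abs_square_le_1)
    qed
    then show "c \<in> ?B \<inter> {c. (\<Sum>i\<in>I. (c i)\<^sup>2) = 1}"
      using c by (simp add: coord_sphere_def PiE_UNIV_domain abs_le_iff)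
  qed (simp add: coord_sphere_def PiE_UNIV_domain Pi_def, metis singletonD)
  then show ?thesis
    using compact_Int_closed[OF cB cl] by simp
qed

lemma nsphere_eq_top_of_set:
  "nsphere m = top_of_set {u. (\<forall>j>m. u j = 0) \<and> (\<Sum>j\<le>m. (u j)\<^sup>2) = 1}"
  by (simp add: nsphere euclidean_product_topology conj_commute)

text \<open>Otherwise the normalised \<open>K\<close>-part of \<open>h\<close> is a retraction of the half sphere onto its equator,
  which would make that sphere contractible.\<close>

lemma half_sphere_linking:
  fixes h :: "('i \<Rightarrow> real) \<Rightarrow> 'i \<Rightarrow> real"
  assumes "finite K" "e \<notin> K" and h: "continuous_on (upper_half_sphere K e) h"
    and fixd: "\<And>c i. c \<in> upper_half_sphere K e \<Longrightarrow> c e = 0 \<Longrightarrow> i \<in> K \<Longrightarrow> h c i = c i"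
  shows "\<exists>c\<in>upper_half_sphere K e. \<forall>i\<in>K. h c i = 0"
proof (cases "K = {}")
  case True
  \<comment> \<open>Without an equator there is no sphere to retract onto; the pole will do.\<close>
  have "(\<lambda>i. if i = e then 1 else 0) \<in> upper_half_sphere K e"
    using True by (auto simp: upper_half_sphere_def coord_sphere_def)
  then show ?thesis using True by blast
next
  case False
  then obtain m where m: "card K = Suc m"
    using assms(1) by (metis card_gt_0_iff gr0_implies_Suc)
  \<comment> \<open>Numbering \<open>K\<close> identifies the equator with the standard
    \<open>nsphere m\<close>, whose non-contractibility is known from homology.\<close>
  obtain b where b: "bij_betw b {..m} K"
    using ex_bij_betw_nat_finite[OF assms(1)] m by (auto simp: atLeast0LessThan lessThan_Suc_atMost)
  define b' where "b' = the_inv_into {..m} b"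
  have b': "bij_betw b' K {..m}"
    unfolding b'_def using b by (rule bij_betw_the_inv_into)
  have b'b: "b' (b j) = j" if "j \<le> m" for j
    using b that by (simp add: b'_def bij_betw_def the_inv_into_f_f)
  have bK: "b j \<in> K" if "j \<le> m" for j
    using b that by (auto simp: bij_betw_def)
  define S where "S = {u::nat \<Rightarrow> real. (\<forall>j>m. u j = 0) \<and> (\<Sum>j\<le>m. (u j)\<^sup>2) = 1}"
  show ?thesis
  proof (rule ccontr)
    assume "\<not> ?thesis"
    then have nz: "\<exists>i\<in>K. h c i \<noteq> 0" if "c \<in> upper_half_sphere K e" for c
      using that by blast
    define N where "N c = sqrt (\<Sum>i\<in>K. (h c i)\<^sup>2)" for c
    have Npos: "N c > 0" if c: "c \<in> upper_half_sphere K e" for c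
      unfolding N_def real_sqrt_gt_0_iff
    proof -
      from nz[OF c] obtain i where "i \<in> K" "h c i \<noteq> 0" by blast
      then show "(\<Sum>i\<in>K. (h c i)\<^sup>2) > 0"
        using assms(1) by (intro sum_pos2[of K i]) auto
    qed
    define R where "R c = (\<lambda>j. if j \<le> m then h c (b j) / N c else 0)" for c
    \<comment> \<open>\<open>L t u\<close> follows the quarter of a great circle from the equatorial
      point \<open>u\<close> to the pole \<open>e\<close>; so \<open>R\<close> after
      \<open>L\<close> deforms the identity of the equator into a constant.\<close>
    define L where "L t u = (\<lambda>i. if i \<in> K then cos t * u (b' i) else if i = e then sin t else 0)"
      for t and u :: "nat \<Rightarrow> real"
    have sumK: "(\<Sum>i\<in>K. g (b' i)) = (\<Sum>j\<le>m. g j)" for g :: "nat \<Rightarrow> real"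
      by (rule sum.reindex_bij_betw[OF b'])
    have sumK': "(\<Sum>j\<le>m. g (b j)) = (\<Sum>i\<in>K. g i)" for g :: "'i \<Rightarrow> real"
      by (rule sum.reindex_bij_betw[OF b])
    have L: "L t u \<in> upper_half_sphere K e" if "u \<in> S" "0 \<le> t" "t \<le> pi / 2" for t u
    proof -
      have "(\<Sum>i\<in>K. (L t u i)\<^sup>2) = (\<Sum>i\<in>K. (cos t)\<^sup>2 * (u (b' i))\<^sup>2)"
        by (intro sum.cong) (auto simp: L_def power_mult_distrib)
      also have "\<dots> = (cos t)\<^sup>2 * (\<Sum>j\<le>m. (u j)\<^sup>2)"
        by (simp add: sumK[of "\<lambda>j. (u j)\<^sup>2"] flip: sum_distrib_left)
      also have "\<dots> = (cos t)\<^sup>2"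
        using that by (simp add: S_def)
      finally have "(\<Sum>i\<in>insert e K. (L t u i)\<^sup>2) = 1"
        using assms(1,2) by (simp add: L_def)
      moreover have "0 \<le> L t u e"
        using that assms(2) by (simp add: L_def sin_ge_zero)
      ultimately show ?thesis
        by (auto simp: upper_half_sphere_def coord_sphere_def L_def)
    qed
    have RS: "R c \<in> S" if c: "c \<in> upper_half_sphere K e" for c
    proof -
      have "(\<Sum>j\<le>m. (R c j)\<^sup>2) = (\<Sum>j\<le>m. (h c (b j))\<^sup>2) / (N c)\<^sup>2"
        by (simp add: R_def power_divide flip: sum_divide_distrib)
      also have "\<dots> = (\<Sum>i\<in>K. (h c i)\<^sup>2) / (N c)\<^sup>2"
        by (simp add: sumK'[of "\<lambda>i. (h c i)\<^sup>2"])
      also have "\<dots> = 1"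
        using Npos[OF c] by (simp add: N_def)
      finally show ?thesis by (auto simp: S_def R_def)
    qed
    have contR: "continuous_on (upper_half_sphere K e) R"
    proof (rule continuous_on_coordinatewise_then_product)
      fix j
      have "continuous_on (upper_half_sphere K e) (\<lambda>c. h c (b j) / N c)"
        unfolding N_def using Npos
        by (intro continuous_intros continuous_on_product_then_coordinatewise[OF h]) (force simp: N_def)
      then show "continuous_on (upper_half_sphere K e) (\<lambda>c. R c j)"
        by (cases "j \<le> m") (auto simp: R_def)
    qed
    have contL: "continuous_on A (\<lambda>p. L (fst p * (pi/2)) (snd p))" for A
    proof (rule continuous_on_coordinatewise_then_product)
      fix i
      show "continuous_on A (\<lambda>p. L (fst p * (pi/2)) (snd p) i)"
        by (cases "i \<in> K"; cases "i = e") (auto simp: L_def intro!: continuous_intros continuous_on_product_then_coordinatewise[OF continuous_on_snd])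
    qed
    have "homotopic_with_canon (\<lambda>x. True) S S id (\<lambda>x. R (L (pi/2) (\<lambda>_. 0)))"
    proof (subst homotopic_with, simp, intro exI conjI ballI)
      let ?h = "\<lambda>p. R (L (fst p * (pi/2)) (snd p))"
      have "continuous_on ({0..1} \<times> S) ?h"
        by (rule continuous_on_compose2[OF contR contL])
           (auto intro!: L simp: mult_le_cancel_right1)
      moreover have "?h ` ({0..1} \<times> S) \<subseteq> S"
        by (auto intro!: RS L simp: mult_le_cancel_right1)
      ultimately show "continuous_map (prod_topology (top_of_set {0..1}) (top_of_set S)) (top_of_set S) ?h"
        by (simp add: image_subset_iff_funcset flip: subtopology_Times)
      fix u assume u: "u \<in> topspace (top_of_set S)"
      then have uS: "u \<in> S" by simp
      have L0: "L 0 u \<in> upper_half_sphere K e" using L[OF uS, of 0] by simp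
      have eq: "h (L 0 u) i = u (b' i)" if "i \<in> K" for i
        using fixd[OF L0 _ that] that assms(2) by (simp add: L_def)
      have "N (L 0 u) = 1"
        using uS unfolding N_def by (simp add: eq sumK[of "\<lambda>j. (u j)\<^sup>2"] S_def)
      then have "R (L 0 u) = u"
        using uS by (auto simp: R_def fun_eq_iff eq bK b'b S_def)
      then show "?h (0, u) = id u" by simp
      have "L (pi/2) u = L (pi/2) (\<lambda>_. 0)"
        by (auto simp: L_def)
      then show "?h (1, u) = R (L (pi/2) (\<lambda>_. 0))" by simp
    qed auto
    then have "contractible S"
      by (auto simp: contractible_def)
    then have "contractible_space (nsphere m)"
      by (simp add: nsphere_eq_top_of_set S_def)
    then show False
      using non_contractible_space_nsphere by blast
  qed
qed

section \<open>Finite-dimensional critical points\<close>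

text \<open>\<open>G\<close> is the gradient. Nothing beyond its continuity can be asked in general:
  a 2-homogeneous function that is twice differentiable at the origin is a quadratic form.\<close>

locale quadratic_hamiltonian =
  fixes H :: "'v::euclidean_space \<Rightarrow> real" and G :: "'v \<Rightarrow> 'v"
  assumes deriv: "(H has_derivative (\<lambda>h. G z \<bullet> h)) (at z)"
    and cont_G: "continuous_on UNIV G"
    and hom: "0 \<le> r \<Longrightarrow> H (r *\<^sub>R z) = r\<^sup>2 * H z"
    and pos: "z \<noteq> 0 \<Longrightarrow> 0 < H z"
begin

lemma cont_H: "continuous_on UNIV H"
  using deriv by (intro has_derivative_continuous_on) auto

lemma H_zero [simp]: "H 0 = 0"
  using hom[of 0 0] by simp

lemma H_bounds:
  obtains m M where "0 < m" "0 < M" "\<And>z. m * (norm z)\<^sup>2 \<le> H z" "\<And>z. H z \<le> M * (norm z)\<^sup>2"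
proof -
  have ne: "sphere (0::'v) 1 \<noteq> {}" by simp
  have c: "continuous_on (sphere 0 1) H"
    using cont_H continuous_on_subset by blast
  obtain x where x: "x \<in> sphere 0 1" "\<And>z. z \<in> sphere 0 1 \<Longrightarrow> H x \<le> H z"
    using continuous_attains_inf[OF compact_sphere ne c] by blast
  obtain y where y: "y \<in> sphere 0 1" "\<And>z. z \<in> sphere 0 1 \<Longrightarrow> H z \<le> H y"
    using continuous_attains_sup[OF compact_sphere ne c] by blast
  have *: "H z = (norm z)\<^sup>2 * H ((1 / norm z) *\<^sub>R z)" if "z \<noteq> 0" for z
    using that by (simp add: hom power_divide)
  have mem: "(1 / norm z) *\<^sub>R z \<in> sphere 0 1" if "z \<noteq> 0" for z
    using that by simp
  show ?thesis
  proof
    show "0 < H x" "0 < H y" using x(1) y(1) by (auto intro!: pos)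
    fix z
    show "H x * (norm z)\<^sup>2 \<le> H z"
      using *[of z] x(2)[OF mem, of z] by (cases "z = 0") (auto simp: mult.commute)
    show "H z \<le> H y * (norm z)\<^sup>2"
      using *[of z] y(2)[OF mem, of z] by (cases "z = 0") (auto simp: mult.commute)
  qed
qed

text \<open>Differentiate \<open>H (r *\<^sub>R z) = r\<^sup>2 * H z\<close> in \<open>z\<close> on
  both sides and compare.\<close>

lemma G_hom:
  assumes "0 < r"
  shows "G (r *\<^sub>R z) = r *\<^sub>R G z"
proof -
  have "((\<lambda>z. H (r *\<^sub>R z)) has_derivative (\<lambda>h. G (r *\<^sub>R z) \<bullet> (r *\<^sub>R h))) (at z)"
    by (rule has_derivative_compose[OF _ deriv]) (auto intro!: derivative_eq_intros)
  moreover have "((\<lambda>z. H (r *\<^sub>R z)) has_derivative (\<lambda>h. r\<^sup>2 * (G z \<bullet> h))) (at z)"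
    unfolding hom[OF less_imp_le[OF assms]] by (auto intro!: derivative_eq_intros deriv)
  ultimately have "(\<lambda>h. G (r *\<^sub>R z) \<bullet> (r *\<^sub>R h)) = (\<lambda>h. r\<^sup>2 * (G z \<bullet> h))"
    by (rule has_derivative_unique)
  then have "G (r *\<^sub>R z) \<bullet> h = (r *\<^sub>R G z) \<bullet> h" for h
    using assms by (auto simp: fun_eq_iff power2_eq_square)
  then show ?thesis
    by (metis vector_eq_rdot)
qed

lemma G_zero [simp]: "G 0 = 0"
  using G_hom[of 2 0] by (simp add: scaleR_2)

lemma G_bound:
  obtains C where "0 \<le> C" "\<And>z. norm (G z) \<le> C * norm z"
proof -
  have "compact (G ` sphere 0 1)"
    by (intro compact_continuous_image continuous_on_subset[OF cont_G]) auto
  then obtain C where C: "\<And>z. z \<in> sphere 0 1 \<Longrightarrow> norm (G z) \<le> C"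
    by (meson bounded_iff compact_imp_bounded image_eqI)
  have "norm (G z) \<le> max C 0 * norm z" for z
  proof (cases "z = 0")
    case False
    have "norm (G ((1 / norm z) *\<^sub>R z)) \<le> C"
      using False by (intro C) simp
    then have "norm (G z) / norm z \<le> C"
      using False by (subst (asm) G_hom) auto
    then show ?thesis
      using False by (simp add: divide_le_eq) (meson max.cobounded1 mult_right_mono norm_ge_zero order_trans)
  qed simp
  then show ?thesis using that[of "max C 0"] by simp
qed

text \<open>Euler's identity, from the derivative of \<open>H (r *\<^sub>R z)\<close> in
  \<open>r\<close> at 1. Homogeneity is given for nonnegative \<open>r\<close> only, so the
  comparison takes place on the open half line.\<close>

lemma euler: "G z \<bullet> z = 2 * H z"
proof -
  have "((\<lambda>r. H (r *\<^sub>R z)) has_derivative (\<lambda>h. G (1 *\<^sub>R z) \<bullet> (h *\<^sub>R z))) (at 1)"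
    by (rule has_derivative_compose[OF _ deriv]) (auto intro!: derivative_eq_intros)
  moreover have "((\<lambda>r. H (r *\<^sub>R z)) has_derivative (\<lambda>h. 2 * h * H z)) (at 1)"
  proof (rule has_derivative_transform_within_open[where s = "{0<..}" and f = "\<lambda>r. r\<^sup>2 * H z"])
    show "((\<lambda>r. r\<^sup>2 * H z) has_derivative (\<lambda>h. 2 * h * H z)) (at 1)"
      by (auto intro!: derivative_eq_intros)
  qed (auto simp: hom)
  ultimately have "(\<lambda>h. G (1 *\<^sub>R z) \<bullet> (h *\<^sub>R z)) = (\<lambda>h. 2 * h * H z)"
    by (rule has_derivative_unique)
  from fun_cong[OF this, of 1] show ?thesis by simp
qed

text \<open>Stands in for a second-order Taylor estimate: uniform continuity of \<open>G\<close> on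
  a compact ball and the mean value inequality make the linearisation error small relative to
  \<open>norm w\<close>, uniformly for bounded \<open>z\<close>.\<close>

lemma uniform_expansion:
  assumes "0 < \<epsilon>"
  obtains \<rho> where "0 < \<rho>"
    "\<And>z w. norm z \<le> R \<Longrightarrow> norm w \<le> \<rho> \<Longrightarrow> \<bar>H (z + w) - H z - G z \<bullet> w\<bar> \<le> \<epsilon> * norm w"
proof -
  \<comment> \<open>The extra 1 in the radius, with \<rho> at most 1, keeps the whole segment from
    \<open>z\<close> to \<open>z + w\<close> in the ball.\<close>
  have "uniformly_continuous_on (cball 0 (R + 1)) G"
    by (intro compact_uniformly_continuous continuous_on_subset[OF cont_G]) auto
  then obtain d where d: "d > 0"
    "\<And>x y. x \<in> cball 0 (R + 1) \<Longrightarrow> y \<in> cball 0 (R + 1) \<Longrightarrow> dist y x < d \<Longrightarrow> dist (G y) (G x) < \<epsilon>"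
    using assms unfolding uniformly_continuous_on_def by blast
  define \<rho> where "\<rho> = min 1 (d / 2)"
  have \<rho>: "0 < \<rho>" "\<rho> \<le> 1" "\<rho> < d" using d(1) by (auto simp: \<rho>_def)
  show ?thesis
  proof (rule that[OF \<rho>(1)])
    fix z w :: 'v assume zw: "norm z \<le> R" "norm w \<le> \<rho>"
    have "norm (H (z + w) - H z - G z \<bullet> ((z + w) - z)) \<le> norm ((z + w) - z) * \<epsilon>"
    proof (rule differentiable_bound_linearization[where S = "cball z \<rho>" and f' = "\<lambda>x h. G x \<bullet> h"])
      show "z + t *\<^sub>R (z + w - z) \<in> cball z \<rho>" if "t \<in> {0..1}" for t
      proof -
        have "\<bar>t\<bar> * norm w \<le> 1 * norm w"
          using that by (intro mult_right_mono) auto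
        then show ?thesis using zw by (simp add: dist_norm)
      qed
      show "(H has_derivative (\<bullet>) (G x)) (at x within cball z \<rho>)" for x
        using deriv has_derivative_at_withinI by blast
      show "onorm ((\<lambda>h. G x \<bullet> h) - (\<lambda>h. G z \<bullet> h)) \<le> \<epsilon>" if x: "x \<in> cball z \<rho>" for x
      proof -
        have "norm x \<le> norm z + dist z x"
          by (metis dist_norm norm_minus_commute norm_triangle_sub)
        then have "dist (G x) (G z) < \<epsilon>"
          using x zw \<rho> by (intro d(2)) (auto simp: dist_commute)
        then have *: "norm (G x - G z) \<le> \<epsilon>" by (simp add: dist_norm)
        show ?thesis
        proof (rule onorm_le)
          fix h :: 'v
          have "\<bar>(G x - G z) \<bullet> h\<bar> \<le> norm (G x - G z) * norm h"
            by (rule Cauchy_Schwarz_ineq2)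
          also have "\<dots> \<le> \<epsilon> * norm h" using * by (intro mult_right_mono) auto
          finally show "norm (((\<lambda>h. G x \<bullet> h) - (\<lambda>h. G z \<bullet> h)) h) \<le> \<epsilon> * norm h"
            by (simp add: inner_diff_left)
        qed
      qed
      show "z \<in> cball z \<rho>" using \<rho> by simp
    qed
    then show "\<bar>H (z + w) - H z - G z \<bullet> w\<bar> \<le> \<epsilon> * norm w" by (simp add: mult.commute)
  qed
qed

end

section \<open>The action quotient on the span of finitely many modes\<close>

locale galerkin = quadratic_hamiltonian H G
  for H :: "'v::euclidean_space \<Rightarrow> real" and G +
  fixes \<phi> :: "'i \<Rightarrow> real \<Rightarrow> 'v" and \<omega> :: "'i \<Rightarrow> real" and I :: "'i set"
  assumes finite_I: "finite I"
    and cont_\<phi>: "continuous_on {0..1} (\<phi> i)"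
    and orthonormal: "i \<in> I \<Longrightarrow> k \<in> I \<Longrightarrow>
      integral {0..1} (\<lambda>t. \<phi> i t \<bullet> \<phi> k t) = (if i = k then 1 else 0)"
begin

definition path where "path c t = (\<Sum>i\<in>I. c i *\<^sub>R \<phi> i t)"
definition energy where "energy c = integral {0..1} (\<lambda>t. H (path c t))"
text \<open>The symplectic action, half the integral of the inner product of -i x' with x, in
  coefficients: \<open>\<omega> i\<close> plays the eigenvalue of -i d/dt on the mode
  \<open>\<phi> i\<close>.\<close>

definition action where "action c = (\<Sum>i\<in>I. \<omega> i * (c i)\<^sup>2) / 2"
definition quot where "quot c = action c / energy c"
text \<open>\<open>energy c\<close> times the gradient of \<open>quot\<close> at \<open>c\<close>.\<close>

definition residual where
  "residual c i = (if i \<in> I then \<omega> i * c i - quot c * integral {0..1} (\<lambda>t. G (path c t) \<bullet> \<phi> i t) else 0)"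

lemma cont_path: "continuous_on {0..1} (path c)"
  unfolding path_def by (intro continuous_intros cont_\<phi>)

lemma cont_H_path: "continuous_on {0..1} (\<lambda>t. H (path c t))"
  by (rule continuous_on_compose2[OF cont_H cont_path]) auto

lemma cont_G_path: "continuous_on {0..1} (\<lambda>t. G (path c t))"
  by (rule continuous_on_compose2[OF cont_G cont_path]) auto

lemma integral_inner_path:
  assumes "continuous_on {0..1} g"
  shows "integral {0..1} (\<lambda>t. g t \<bullet> path c t) = (\<Sum>i\<in>I. c i * integral {0..1} (\<lambda>t. g t \<bullet> \<phi> i t))"
proof -
  have "integral {0..1} (\<lambda>t. g t \<bullet> path c t) = integral {0..1} (\<lambda>t. \<Sum>i\<in>I. c i * (g t \<bullet> \<phi> i t))"
    by (simp add: path_def inner_sum_right)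
  also have "\<dots> = (\<Sum>i\<in>I. integral {0..1} (\<lambda>t. c i * (g t \<bullet> \<phi> i t)))"
    using finite_I
    by (intro integral_sum integrable_continuous_real continuous_intros assms cont_\<phi>)
  finally show ?thesis by simp
qed

lemma integral_path_\<phi>:
  assumes "i \<in> I"
  shows "integral {0..1} (\<lambda>t. path c t \<bullet> \<phi> i t) = c i"
proof -
  have "integral {0..1} (\<lambda>t. path c t \<bullet> \<phi> i t) = integral {0..1} (\<lambda>t. \<phi> i t \<bullet> path c t)"
    by (simp add: inner_commute)
  also have "\<dots> = (\<Sum>k\<in>I. c k * (if i = k then 1 else 0))"
    using assms by (simp add: integral_inner_path cont_\<phi> orthonormal)
  also have "\<dots> = c i"
    using assms finite_I by (simp add: if_distrib cong: if_cong)
  finally show ?thesis .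
qed

lemma parseval: "integral {0..1} (\<lambda>t. path c t \<bullet> path d t) = (\<Sum>i\<in>I. c i * d i)"
  by (simp add: integral_inner_path cont_path integral_path_\<phi> mult.commute)

lemma parseval_norm: "integral {0..1} (\<lambda>t. (norm (path c t))\<^sup>2) = (\<Sum>i\<in>I. (c i)\<^sup>2)"
  using parseval[of c c] unfolding power2_norm_eq_inner by (simp add: power2_eq_square)

lemma cont_path_joint: "continuous_on (A \<times> {0..1}) (\<lambda>p. path (fst p) (snd p))"
proof -
  have "continuous_on (A \<times> {0..1}) (\<lambda>p. \<phi> i (snd p))" for i
    by (rule continuous_on_compose2[OF cont_\<phi> continuous_on_snd]) (auto intro: continuous_on_id)
  then show ?thesis
    unfolding path_def
    by (intro continuous_intros continuous_on_product_then_coordinatewise[OF continuous_on_fst])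
qed

lemma cont_energy: "continuous_on A energy"
proof -
  have "continuous_on (A \<times> {0..1}) (\<lambda>(c, t). H (path c t))"
    using continuous_on_compose2[OF cont_H cont_path_joint] by (auto simp: case_prod_beta)
  then show ?thesis
    using integral_continuous_on_param[of A 0 1 "\<lambda>c t. H (path c t)"]
    by (simp add: energy_def[abs_def])
qed

lemma cont_G_coeff: "continuous_on A (\<lambda>c. integral {0..1} (\<lambda>t. G (path c t) \<bullet> \<phi> i t))"
proof -
  have "continuous_on (A \<times> {0..1}) (\<lambda>p. \<phi> i (snd p))" for i
    by (rule continuous_on_compose2[OF cont_\<phi> continuous_on_snd]) (auto intro: continuous_on_id)
  moreover have "continuous_on (A \<times> {0..1}) (\<lambda>p. G (path (fst p) (snd p)))"
    by (rule continuous_on_compose2[OF cont_G cont_path_joint]) auto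
  ultimately have "continuous_on (A \<times> {0..1}) (\<lambda>(c, t). G (path c t) \<bullet> \<phi> i t)"
    by (auto simp: case_prod_beta intro!: continuous_intros)
  then show ?thesis
    using integral_continuous_on_param[of A 0 1 "\<lambda>c t. G (path c t) \<bullet> \<phi> i t"] by simp
qed

lemma cont_action: "continuous_on A action"
  unfolding action_def[abs_def]
  by (intro continuous_intros continuous_on_subset[OF continuous_on_product_coordinates]) auto

lemma energy_bounds:
  assumes "\<And>z. m * (norm z)\<^sup>2 \<le> H z" "\<And>z. H z \<le> M * (norm z)\<^sup>2"
  shows "m * (\<Sum>i\<in>I. (c i)\<^sup>2) \<le> energy c" "energy c \<le> M * (\<Sum>i\<in>I. (c i)\<^sup>2)"
proof -
  have i: "(\<lambda>t. k * (norm (path c t))\<^sup>2) integrable_on {0..1}" for k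
    by (intro integrable_continuous_real continuous_intros cont_path)
  have iH: "(\<lambda>t. H (path c t)) integrable_on {0..1}"
    by (intro integrable_continuous_real cont_H_path)
  show "m * (\<Sum>i\<in>I. (c i)\<^sup>2) \<le> energy c"
    using integral_le[OF i[of m] iH] assms(1) by (simp add: energy_def parseval_norm)
  show "energy c \<le> M * (\<Sum>i\<in>I. (c i)\<^sup>2)"
    using integral_le[OF iH i[of M]] assms(2) by (simp add: energy_def parseval_norm)
qed

lemma energy_pos:
  assumes "0 < (\<Sum>i\<in>I. (c i)\<^sup>2)"
  shows "0 < energy c"
proof -
  obtain m M where "0 < m" "0 < M" "\<And>z. m * (norm z)\<^sup>2 \<le> H z" "\<And>z. H z \<le> M * (norm z)\<^sup>2"
    by (rule H_bounds) blast
  then show ?thesis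
    using energy_bounds(1)[of m M c] assms by (smt (verit) mult_pos_pos)
qed

lemma energy_pos_sphere: "c \<in> coord_sphere I \<Longrightarrow> 0 < energy c"
  by (rule energy_pos) (simp add: coord_sphere_def)

lemma cont_quot: "continuous_on (coord_sphere I) quot"
  unfolding quot_def[abs_def]
  using energy_pos_sphere by (intro continuous_intros cont_action cont_energy) force

lemma cont_residual: "continuous_on (coord_sphere I) (\<lambda>c. residual c i)"
  unfolding residual_def
  by (cases "i \<in> I")
     (auto intro!: continuous_intros cont_quot cont_G_coeff
        continuous_on_subset[OF continuous_on_product_coordinates])

lemma path_scale: "path (\<lambda>i. r * c i) t = r *\<^sub>R path c t"
  by (simp add: path_def scaleR_sum_right)

lemma quot_scale:
  assumes "0 < r"
  shows "quot (\<lambda>i. r * c i) = quot c"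
proof -
  have "energy (\<lambda>i. r * c i) = r\<^sup>2 * energy c"
    using assms by (simp add: energy_def path_scale hom)
  moreover have "action (\<lambda>i. r * c i) = r\<^sup>2 * action c"
    by (simp add: action_def power_mult_distrib sum_distrib_left mult_ac)
  ultimately show ?thesis using assms by (simp add: quot_def)
qed

text \<open>\<open>quot\<close> is constant on rays, so its gradient has no radial part. A step
  along the residual thus never shortens a unit vector, and normalising afterwards is
  harmless.\<close>

lemma residual_orthogonal:
  assumes "c \<in> coord_sphere I"
  shows "(\<Sum>i\<in>I. c i * residual c i) = 0"
proof -
  have "(\<Sum>i\<in>I. c i * residual c i) =
      (\<Sum>i\<in>I. \<omega> i * (c i)\<^sup>2) - quot c * (\<Sum>i\<in>I. c i * integral {0..1} (\<lambda>t. G (path c t) \<bullet> \<phi> i t))"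
    by (simp add: residual_def right_diff_distrib sum_subtractf sum_distrib_left mult_ac power2_eq_square)
  also have "(\<Sum>i\<in>I. c i * integral {0..1} (\<lambda>t. G (path c t) \<bullet> \<phi> i t)) = 2 * energy c"
    by (subst integral_inner_path[symmetric, OF cont_G_path]) (simp add: euler energy_def)
  finally show ?thesis
    using energy_pos_sphere[OF assms] by (simp add: quot_def action_def)
qed

lemma path_diff: "path (\<lambda>i. c i - u * d i) t = path c t - u *\<^sub>R path d t"
  by (simp add: path_def scaleR_diff_left sum_subtractf scaleR_sum_right)

text \<open>A deformation lemma without a flow: \<open>T\<close> takes one step against the residual
  and normalises. The step length is proportional to the gap \<open>quot c - a\<close>, and
  compactness of the strip gives one contraction factor for all points.\<close>

lemma descent_step:
  assumes ab: "0 < a" "a \<le> b"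
    and noncrit: "\<And>c. c \<in> coord_sphere I \<Longrightarrow> a \<le> quot c \<Longrightarrow> quot c \<le> b \<Longrightarrow> \<exists>i\<in>I. residual c i \<noteq> 0"
  obtains T \<kappa> where "0 < \<kappa>" "\<kappa> \<le> (1::real)" "continuous_on (coord_sphere I) T"
    "T ` coord_sphere I \<subseteq> coord_sphere I"
    "\<And>c. c \<in> coord_sphere I \<Longrightarrow> quot c \<le> a \<Longrightarrow> T c = c"
    "\<And>c. c \<in> coord_sphere I \<Longrightarrow> a \<le> quot c \<Longrightarrow> quot c \<le> b \<Longrightarrow>
      quot (T c) - a \<le> (1 - \<kappa>) * (quot c - a)"
proof (cases "\<exists>c\<in>coord_sphere I. a \<le> quot c \<and> quot c \<le> b")
  \<comment> \<open>In an empty strip the contraction property is vacuous, so the identity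
    serves.\<close>
  case False
  then show ?thesis by (intro that[of 1 id]) auto
next
  case True
  let ?S = "coord_sphere I"
  have cS: "compact ?S" by (rule compact_coord_sphere[OF finite_I])
  have neS: "?S \<noteq> {}" using True by blast
  define Z where "Z = {c \<in> ?S. quot c \<in> {a..b}}"
  have "closedin (top_of_set ?S) Z"
    unfolding Z_def by (rule continuous_closedin_preimage[OF cont_quot, unfolded vimage_def, of "{a..b}", simplified Int_def Collect_mem_eq mem_Collect_eq]) simp
  then have cZ: "compact Z" using cS closedin_compact by blast
  have neZ: "Z \<noteq> {}" using True by (auto simp: Z_def)
  have ZS: "Z \<subseteq> ?S" by (auto simp: Z_def)
  define n2 where "n2 c = (\<Sum>i\<in>I. (residual c i)\<^sup>2)" for c
  have cn2: "continuous_on ?S n2"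
    unfolding n2_def[abs_def] by (intro continuous_intros cont_residual)
  obtain z where z: "z \<in> Z" "\<And>c. c \<in> Z \<Longrightarrow> n2 z \<le> n2 c"
    using continuous_attains_inf[OF cZ neZ continuous_on_subset[OF cn2 ZS]] by blast
  \<comment> \<open>The least squared residual on the compact strip, positive because the strip has
    no critical point.\<close>
  define D where "D = n2 z"
  have D: "D > 0"
  proof -
    obtain i where "i \<in> I" "residual z i \<noteq> 0"
      using noncrit[of z] z(1) by (auto simp: Z_def)
    then show ?thesis
      unfolding D_def n2_def using finite_I by (intro sum_pos2[of I i]) auto
  qed
  obtain P where P: "\<And>c. c \<in> ?S \<Longrightarrow> n2 c \<le> P"
    using continuous_attains_sup[OF cS neS cn2] by blast
  have cres: "continuous_on ?S residual"
    by (intro continuous_on_coordinatewise_then_product cont_residual)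
  have "continuous_on ?S (\<lambda>c. action (residual c))"
    by (rule continuous_on_compose2[OF cont_action cres subset_refl])
  from continuous_attains_sup[OF cS neS this]
  obtain q0 where q0: "\<And>c. c \<in> ?S \<Longrightarrow> action (residual c) \<le> q0" by blast
  \<comment> \<open>Bounds the quadratic term of the action along a step. The action is indefinite,
    hence the maximum with 0.\<close>
  define q where "q = max q0 0"
  have q: "q \<ge> 0" "\<And>c. c \<in> ?S \<Longrightarrow> action (residual c) \<le> q"
    using q0 by (auto simp: q_def max.coboundedI1)
  have bounded_path: "\<exists>R>0. \<forall>c\<in>?S. \<forall>t\<in>{0..1}. norm (path (f c) t) \<le> R"
    if "continuous_on ?S f" for f
  proof -
    have "continuous_on (?S \<times> {0..1}) (\<lambda>p. (f (fst p), snd p))"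
      by (intro continuous_intros continuous_on_compose2[OF that continuous_on_fst]) auto
    then have "continuous_on (?S \<times> {0..1})
        (\<lambda>p. (\<lambda>p. path (fst p) (snd p)) (f (fst p), snd p))"
      by (rule continuous_on_compose2[OF cont_path_joint[of UNIV]]) auto
    then have "continuous_on (?S \<times> {0..1}) (\<lambda>p. path (f (fst p)) (snd p))" by simp
    then have "compact ((\<lambda>p. path (f (fst p)) (snd p)) ` (?S \<times> {0..1}))"
      by (intro compact_continuous_image compact_Times cS) auto
    then obtain R where "R > 0" "\<And>x. x \<in> (\<lambda>p. path (f (fst p)) (snd p)) ` (?S \<times> {0..1}) \<Longrightarrow> norm x \<le> R"
      by (meson bounded_pos compact_imp_bounded)
    then show ?thesis by force
  qed
  obtain R where R: "R > 0" "\<And>c t. c \<in> ?S \<Longrightarrow> t \<in> {0..1} \<Longrightarrow> norm (path c t) \<le> R"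
    using bounded_path[of "\<lambda>c. c"] by (auto intro: continuous_on_id)
  obtain R2 where R2: "R2 > 0" "\<And>c t. c \<in> ?S \<Longrightarrow> t \<in> {0..1} \<Longrightarrow> norm (path (residual c) t) \<le> R2"
    using bounded_path[OF cres] by auto
  have b: "b > 0" using ab by simp
  \<comment> \<open>Calibrated so that the linearisation error of the energy, multiplied by a level
    of at most \<open>b\<close>, costs at most a quarter of the first-order gain
    \<open>D\<close>.\<close>
  define \<epsilon> where "\<epsilon> = D / (4 * b * R2)"
  have \<epsilon>: "\<epsilon> > 0" "b * (\<epsilon> * R2) = D / 4" using D b R2(1) by (auto simp: \<epsilon>_def)
  obtain \<rho> where \<rho>: "0 < \<rho>"
    "\<And>z w. norm z \<le> R \<Longrightarrow> norm w \<le> \<rho> \<Longrightarrow> \<bar>H (z + w) - H z - G z \<bullet> w\<bar> \<le> \<epsilon> * norm w"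
    using uniform_expansion[OF \<epsilon>(1)] by blast
  \<comment> \<open>The first bound keeps displacements within \<rho>; the second limits the
    quadratic term of the action to another quarter of \<open>D\<close>, where \<open>q + 1\<close>
    avoids a zero denominator. Half of \<open>D\<close> survives.\<close>
  define s where "s = min (\<rho> / (b * R2)) (D / (4 * b * (q + 1)))"
  have s: "s > 0" "s * b * R2 \<le> \<rho>" "s * b * q \<le> D / 4"
  proof -
    show "s > 0" using \<rho>(1) b R2(1) D q by (simp add: s_def)
    have "s \<le> \<rho> / (b * R2)" by (simp add: s_def)
    then show "s * b * R2 \<le> \<rho>" using b R2(1) by (simp add: field_simps)
    have "s \<le> D / (4 * b * (q + 1))" by (simp add: s_def)
    moreover have "0 < 4 * b * (q + 1)" using b q by simp
    ultimately have "s * (4 * b * (q + 1)) \<le> D" by (simp only: pos_le_divide_eq)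
    then have "s * b * (q + 1) \<le> D / 4" by (simp add: mult_ac)
    moreover have "s * b * q \<le> s * b * (q + 1)" using \<open>s > 0\<close> b by simp
    ultimately show "s * b * q \<le> D / 4" by linarith
  qed
  obtain m M where mM: "0 < m" "0 < M" "\<And>z. m * (norm z)\<^sup>2 \<le> H z" "\<And>z. H z \<le> M * (norm z)\<^sup>2"
    by (rule H_bounds) blast
  \<comment> \<open>An upper bound for the energy after a step, needed to turn a gain in the
    numerator into a gain of the quotient.\<close>
  define E where "E = M * (1 + (s * b)\<^sup>2 * P)"
  \<comment> \<open>The cutoff makes \<open>T\<close> the identity below level \<open>a\<close>; elsewhere the gap \<open>quot c - a\<close> shrinks by a fixed
    factor.\<close>
  define u where "u c = s * max 0 (quot c - a)" for c
  define v where "v c i = c i - u c * residual c i" for c i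
  define T where "T c i = v c i / sqrt (\<Sum>i\<in>I. (v c i)\<^sup>2)" for c i
  have u0: "u c \<ge> 0" for c using s(1) by (simp add: u_def)
  \<comment> \<open>Pythagoras, by \<open>residual_orthogonal\<close>.\<close>
  have nv: "(\<Sum>i\<in>I. (v c i)\<^sup>2) = 1 + (u c)\<^sup>2 * n2 c" if "c \<in> ?S" for c
  proof -
    have "(\<Sum>i\<in>I. (v c i)\<^sup>2) = (\<Sum>i\<in>I. (c i)\<^sup>2) - 2 * u c * (\<Sum>i\<in>I. c i * residual c i) + (u c)\<^sup>2 * n2 c"
      by (simp add: v_def n2_def power2_diff sum.distrib sum_subtractf sum_distrib_left power_mult_distrib mult_ac)
    then show ?thesis
      using that residual_orthogonal[OF that] by (simp add: coord_sphere_def)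
  qed
  have n2_nonneg: "n2 c \<ge> 0" for c by (simp add: n2_def sum_nonneg)
  have nv1: "(\<Sum>i\<in>I. (v c i)\<^sup>2) \<ge> 1" if "c \<in> ?S" for c
    using nv[OF that] n2_nonneg by simp
  have cv: "continuous_on ?S (\<lambda>c. v c i)" for i
    unfolding v_def u_def
    by (intro continuous_intros cont_quot cont_residual continuous_on_subset[OF continuous_on_product_coordinates]) auto
  \<comment> \<open>The numerator gains at least \<open>u c * (D / 2)\<close> and the energy is at
    most \<open>E\<close>, which gives the factor \<open>s * D / (2 * E)\<close>. The minimum with 1
    keeps \<open>1 - \<kappa>\<close> nonnegative for the iteration.\<close>
  show ?thesis
  proof (rule that[of "min 1 (s * D / (2 * E))" T])
    have P0: "P \<ge> 0" using P[of z] n2_nonneg[of z] z(1) ZS by force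
    have E: "E > 0" using mM(2) P0 by (simp add: E_def add_pos_nonneg)
    show "0 < min 1 (s * D / (2 * E))" using s(1) D E by simp
    show "min 1 (s * D / (2 * E)) \<le> 1" by simp
    show "continuous_on ?S T"
      unfolding T_def[abs_def] using nv1
      by (intro continuous_on_coordinatewise_then_product continuous_intros cv) force
    show "T ` ?S \<subseteq> ?S"
    proof clarify
      fix c assume c: "c \<in> ?S"
      have "(\<Sum>i\<in>I. (T c i)\<^sup>2) = 1"
        using nv1[OF c] by (simp add: T_def power_divide flip: sum_divide_distrib)
      moreover have "T c i = 0" if "i \<notin> I" for i
        using c that by (simp add: T_def v_def residual_def coord_sphere_def)
      ultimately show "T c \<in> ?S" by (simp add: coord_sphere_def)
    qed
    show "T c = c" if c: "c \<in> ?S" "quot c \<le> a" for c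
    proof -
      have "u c = 0" using c(2) by (simp add: u_def)
      then have "v c = c" by (simp add: v_def fun_eq_iff)
      then show ?thesis using c(1) by (simp add: T_def fun_eq_iff coord_sphere_def)
    qed
    fix c assume c: "c \<in> ?S" "a \<le> quot c" "quot c \<le> b"
    define f where "f = quot c"
    have f: "0 < f" "f \<le> b" using c ab by (auto simp: f_def)
    have uf: "u c = s * (f - a)" using c by (simp add: u_def f_def)
    have ub: "u c \<le> s * b"
      unfolding uf using f ab s(1) by (intro mult_left_mono) auto
    have n2D: "D \<le> n2 c" unfolding D_def using c by (intro z(2)) (simp add: Z_def)
    have Qv: "action (v c) = action c - u c * (\<Sum>i\<in>I. \<omega> i * c i * residual c i) + (u c)\<^sup>2 * action (residual c)"
    proof -
      have "(\<Sum>i\<in>I. \<omega> i * (v c i)\<^sup>2) = (\<Sum>i\<in>I. \<omega> i * (c i)\<^sup>2 - 2 * u c * (\<omega> i * c i * residual c i)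
          + (u c)\<^sup>2 * (\<omega> i * (residual c i)\<^sup>2))"
        by (intro sum.cong refl) (simp add: v_def power2_eq_square algebra_simps)
      also have "\<dots> = (\<Sum>i\<in>I. \<omega> i * (c i)\<^sup>2) - 2 * u c * (\<Sum>i\<in>I. \<omega> i * c i * residual c i)
          + (u c)\<^sup>2 * (\<Sum>i\<in>I. \<omega> i * (residual c i)\<^sup>2)"
        by (simp only: sum.distrib sum_subtractf sum_distrib_left)
      finally show ?thesis
        by (simp add: action_def add_divide_distrib diff_divide_distrib)
    qed
    define g where "g = (\<Sum>i\<in>I. residual c i * integral {0..1} (\<lambda>t. G (path c t) \<bullet> \<phi> i t))"
    \<comment> \<open>The first-order decrease of \<open>action - f * energy\<close> per unit step
      is exactly the squared residual.\<close>
    have ni: "(\<Sum>i\<in>I. \<omega> i * c i * residual c i) - f * g = n2 c"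
      unfolding g_def n2_def f_def
      by (simp add: sum_distrib_left residual_def power2_eq_square left_diff_distrib mult_ac
          flip: sum_subtractf)
    have Ev: "energy c - u c * g - \<epsilon> * (u c * R2) \<le> energy (v c)"
    proof -
      have pt: "H (path c t) - u c * (G (path c t) \<bullet> path (residual c) t) - \<epsilon> * (u c * R2) \<le> H (path (v c) t)"
        if t: "t \<in> {0..1}" for t
      proof -
        define w where "w = - (u c *\<^sub>R path (residual c) t)"
        have nw: "norm w \<le> u c * R2"
          using R2(2)[OF c(1) t] u0[of c] by (simp add: w_def mult_left_mono)
        also have "\<dots> \<le> \<rho>"
          using mult_right_mono[OF ub, of R2] R2(1) s(2) by linarith
        finally have "\<bar>H (path c t + w) - H (path c t) - G (path c t) \<bullet> w\<bar> \<le> \<epsilon> * norm w"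
          by (intro \<rho>(2) R(2) c t)
        also have "\<dots> \<le> \<epsilon> * (u c * R2)" using nw \<epsilon>(1) by simp
        finally have "\<bar>H (path c t + w) - H (path c t) - G (path c t) \<bullet> w\<bar> \<le> \<epsilon> * (u c * R2)" .
        moreover have "path (v c) t = path c t + w"
          by (simp add: v_def[abs_def] path_diff w_def)
        ultimately show ?thesis by (simp add: w_def)
      qed
      have iG': "(\<lambda>t. r * (G (path c t) \<bullet> path (residual c) t)) integrable_on {0..1}" for r
        by (intro integrable_continuous_real continuous_intros cont_G_path cont_path)
      have iH: "(\<lambda>t. H (path d t)) integrable_on {0..1}" for d
        by (intro integrable_continuous_real cont_H_path)
      have "integral {0..1} (\<lambda>t. H (path c t) - u c * (G (path c t) \<bullet> path (residual c) t) - \<epsilon> * (u c * R2))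
          \<le> energy (v c)"
        unfolding energy_def
        by (intro integral_le pt integrable_continuous_real continuous_intros cont_H_path cont_G_path cont_path)
      also have "integral {0..1} (\<lambda>t. H (path c t) - u c * (G (path c t) \<bullet> path (residual c) t) - \<epsilon> * (u c * R2))
          = energy c - u c * g - \<epsilon> * (u c * R2)"
        by (simp add: integral_diff integrable_diff iH iG' integrable_const_ivl
            energy_def g_def integral_inner_path cont_G_path)
      finally show ?thesis .
    qed
    have Epos: "energy (v c) > 0"
      using nv1[OF c(1)] by (intro energy_pos) linarith
    have Ele: "energy (v c) \<le> E"
    proof -
      have "(u c)\<^sup>2 * n2 c \<le> (s * b)\<^sup>2 * P"
        using ub u0[of c] P[OF c(1)] n2_nonneg by (intro mult_mono power_mono) auto
      then have "M * (\<Sum>i\<in>I. (v c i)\<^sup>2) \<le> E"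
        unfolding E_def nv[OF c(1)] using mM(2) by (intro mult_left_mono) auto
      then show ?thesis
        using energy_bounds(2)[OF mM(3,4), of "v c"] by linarith
    qed
    \<comment> \<open>With the level \<open>f\<close> frozen, \<open>action - f * energy\<close>
      vanishes at \<open>c\<close>; its sign at \<open>v c\<close> compares the two quotients
      without differentiating a quotient.\<close>
    have "action (v c) - f * energy (v c) \<le> - u c * (D / 2)"
    proof -
      have "f * energy (v c) \<ge> f * (energy c - u c * g - \<epsilon> * (u c * R2))"
        using Ev f by (intro mult_left_mono) auto
      moreover have "action c = f * energy c"
        using energy_pos_sphere[OF c(1)] by (simp add: f_def quot_def)
      moreover have "f * (\<epsilon> * (u c * R2)) \<le> u c * (D / 4)"
      proof -
        have "f * (\<epsilon> * (u c * R2)) \<le> b * (\<epsilon> * (u c * R2))"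
          using f \<epsilon>(1) u0[of c] R2(1) by (intro mult_right_mono) auto
        also have "\<dots> = u c * (b * (\<epsilon> * R2))" by simp
        finally show ?thesis by (simp add: \<epsilon>(2))
      qed
      moreover have "(u c)\<^sup>2 * action (residual c) \<le> u c * (D / 4)"
      proof -
        have "(u c)\<^sup>2 * action (residual c) \<le> (u c)\<^sup>2 * q"
          using q(2)[OF c(1)] by (intro mult_left_mono) auto
        also have "\<dots> \<le> u c * (s * b * q)"
          unfolding power2_eq_square mult.assoc
          using ub q(1) u0[of c] by (intro mult_left_mono) (auto simp: mult_right_mono simp flip: mult.assoc)
        also have "\<dots> \<le> u c * (D / 4)"
          using s(3) u0[of c] by (intro mult_left_mono)
        finally show ?thesis .
      qed
      moreover have "u c * n2 c \<ge> u c * D"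
        using n2D u0[of c] by (intro mult_left_mono)
      moreover have "u c * n2 c = u c * (\<Sum>i\<in>I. \<omega> i * c i * residual c i) - f * (u c * g)"
        unfolding ni[symmetric] by (simp add: algebra_simps)
      ultimately show ?thesis
        unfolding Qv right_diff_distrib by simp
    qed
    then have "(action (v c) - f * energy (v c)) / energy (v c) \<le> - u c * (D / 2) / energy (v c)"
      using Epos by (intro divide_right_mono) auto
    then have "quot (v c) - f \<le> - u c * (D / 2) / energy (v c)"
      using Epos by (simp add: quot_def diff_divide_distrib)
    also have "\<dots> \<le> - u c * (D / 2) / E"
      using Epos Ele u0[of c] D by (simp add: divide_left_mono mult_nonneg_nonneg)
    also have "\<dots> = - (s * D / (2 * E)) * (f - a)"
      by (simp add: uf)
    also have "\<dots> \<le> - (min 1 (s * D / (2 * E))) * (f - a)"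
      using c by (intro mult_right_mono) (auto simp: f_def)
    finally have "quot (v c) - a \<le> (1 - min 1 (s * D / (2 * E))) * (f - a)"
      by (simp add: algebra_simps)
    moreover have "quot (T c) = quot (v c)"
      using quot_scale[of "1 / sqrt (\<Sum>i\<in>I. (v c i)\<^sup>2)" "v c"] nv1[OF c(1)]
      by (simp add: T_def[abs_def])
    ultimately show "quot (T c) - a \<le> (1 - min 1 (s * D / (2 * E))) * (quot c - a)"
      by (simp add: f_def)
  qed
qed

text \<open>On unit vectors of purely positive modes \<open>quot\<close> is at least
  \<open>w / (2 * M)\<close>; on the half sphere it is at most \<open>\<omega> e / (2 * m)\<close>,
  and on its equator at most 0. Without critical values in between, iterating
  \<open>descent_step\<close> would push the half sphere below the first level with its equator
  fixed, against the linking. \<open>a\<close> is half of that level because the iterates come down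
  to \<open>a\<close> only in the limit. Both bounds depend on \<open>I\<close> through
  \<open>w\<close> and \<open>e\<close> alone.\<close>

theorem critical_point:
  assumes e: "e \<in> I" "0 < \<omega> e"
    and w: "0 < w" "\<And>i. i \<in> I \<Longrightarrow> 0 < \<omega> i \<Longrightarrow> w \<le> \<omega> i"
    and mM: "0 < m" "0 < M" "\<And>z. m * (norm z)\<^sup>2 \<le> H z" "\<And>z. H z \<le> M * (norm z)\<^sup>2"
  obtains c \<tau> where "c \<in> coord_sphere I" "w / (4 * M) \<le> \<tau>" "\<tau> \<le> \<omega> e / (2 * m)"
    "\<And>i. i \<in> I \<Longrightarrow> \<omega> i * c i = \<tau> * integral {0..1} (\<lambda>t. G (path c t) \<bullet> \<phi> i t)"
proof -
  define a where "a = w / (4 * M)"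
  define b where "b = \<omega> e / (2 * m)"
  let ?S = "coord_sphere I"
  define K where "K = {i\<in>I. \<omega> i \<le> 0}"
  have K: "finite K" "e \<notin> K" "insert e K \<subseteq> I" using finite_I e by (auto simp: K_def)
  let ?D = "upper_half_sphere K e"
  have a: "0 < a" using w mM by (simp add: a_def)
  have DS: "?D \<subseteq> ?S"
  proof
    fix c assume c: "c \<in> ?D"
    then have "c i = 0" if "i \<notin> insert e K" for i
      using that by (auto simp: upper_half_sphere_def coord_sphere_def)
    then have "(\<Sum>i\<in>I. (c i)\<^sup>2) = (\<Sum>i\<in>insert e K. (c i)\<^sup>2)"
      using K finite_I by (intro sum.mono_neutral_right) auto
    then show "c \<in> ?S"
      using c K(3) by (auto simp: upper_half_sphere_def coord_sphere_def)
  qed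
  have up: "action c \<le> \<omega> e * (c e)\<^sup>2 / 2" if c: "c \<in> ?D" for c
  proof -
    have "(\<Sum>i\<in>I. \<omega> i * (c i)\<^sup>2) = (\<Sum>i\<in>insert e K. \<omega> i * (c i)\<^sup>2)"
      using K finite_I c by (intro sum.mono_neutral_right) (auto simp: upper_half_sphere_def coord_sphere_def)
    also have "\<dots> = \<omega> e * (c e)\<^sup>2 + (\<Sum>i\<in>K. \<omega> i * (c i)\<^sup>2)"
      using K by simp
    also have "\<dots> \<le> \<omega> e * (c e)\<^sup>2"
      using sum_nonpos[of K "\<lambda>i. \<omega> i * (c i)\<^sup>2"] by (simp add: K_def mult_nonpos_nonneg)
    finally show ?thesis by (simp add: action_def)
  qed
  have quot_b: "quot c \<le> b" if c: "c \<in> ?D" for c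
  proof -
    have cS: "c \<in> ?S" using DS c by blast
    have "(c e)\<^sup>2 \<le> (\<Sum>i\<in>I. (c i)\<^sup>2)"
      using e finite_I by (intro member_le_sum) auto
    then have "\<omega> e * (c e)\<^sup>2 \<le> \<omega> e"
      using cS e by (simp add: coord_sphere_def)
    then have "action c \<le> \<omega> e / 2" using up[OF c] by linarith
    moreover have "m \<le> energy c"
      using energy_bounds(1)[OF mM(3,4), of c] cS by (simp add: coord_sphere_def)
    ultimately have "action c / energy c \<le> (\<omega> e / 2) / m"
      using mM(1) e by (intro frac_le) auto
    then show ?thesis by (simp add: quot_def b_def mult.commute)
  qed
  have quot_0: "quot c \<le> 0" if c: "c \<in> ?D" "c e = 0" for c
  proof -
    have "action c \<le> 0" using up[OF c(1)] c(2) by simp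
    then show ?thesis
      using energy_pos_sphere[of c] DS c by (auto simp: quot_def divide_nonpos_pos)
  qed
  have quot_2a: "2 * a \<le> quot c" if c: "c \<in> ?S" "\<forall>i\<in>K. c i = 0" for c
  proof -
    have "w * (\<Sum>i\<in>I. (c i)\<^sup>2) \<le> (\<Sum>i\<in>I. \<omega> i * (c i)\<^sup>2)"
      unfolding sum_distrib_left
    proof (rule sum_mono)
      fix i assume "i \<in> I"
      then show "w * (c i)\<^sup>2 \<le> \<omega> i * (c i)\<^sup>2"
        using w(2)[of i] c(2) by (cases "\<omega> i \<le> 0") (auto simp: K_def mult_right_mono)
    qed
    then have "w / 2 \<le> action c" using c(1) by (simp add: coord_sphere_def action_def)
    moreover have "energy c \<le> M"
      using energy_bounds(2)[OF mM(3,4), of c] c by (simp add: coord_sphere_def)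
    ultimately have "(w / 2) / M \<le> action c / energy c"
      using w energy_pos_sphere[OF c(1)] by (intro frac_le) auto
    then show ?thesis by (simp add: quot_def a_def)
  qed
  have "\<exists>c\<in>?S. a \<le> quot c \<and> quot c \<le> b \<and> (\<forall>i\<in>I. residual c i = 0)"
  proof (rule ccontr)
    assume neg: "\<not> ?thesis"
    \<comment> \<open>Linking for the identity map yields a point of the half sphere to which both
      estimates apply.\<close>
    have ab: "a \<le> b"
    proof -
      obtain c where c: "c \<in> ?D" "\<forall>i\<in>K. c i = 0"
        using half_sphere_linking[OF K(1,2), of "\<lambda>c. c"] by (auto intro: continuous_on_id)
      then show ?thesis using quot_2a[of c] quot_b[of c] DS a by auto
    qed
    obtain T \<kappa> where T: "0 < \<kappa>" "\<kappa> \<le> (1::real)" "continuous_on ?S T"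
      "T ` ?S \<subseteq> ?S" "\<And>c. c \<in> ?S \<Longrightarrow> quot c \<le> a \<Longrightarrow> T c = c"
      "\<And>c. c \<in> ?S \<Longrightarrow> a \<le> quot c \<Longrightarrow> quot c \<le> b \<Longrightarrow> quot (T c) - a \<le> (1 - \<kappa>) * (quot c - a)"
      using descent_step[OF a ab] neg by metis
    \<comment> \<open>The equator stays fixed since \<open>quot\<close> is at most 0 there, hence
      below \<open>a\<close>; points that have dropped to \<open>a\<close> or lower no longer
      move.\<close>
    have iter: "continuous_on ?D (T ^^ n) \<and> (\<forall>c\<in>?D. (T ^^ n) c \<in> ?S \<and>
        (c e = 0 \<longrightarrow> (T ^^ n) c = c) \<and> quot ((T ^^ n) c) - a \<le> (1 - \<kappa>) ^ n * (b - a))" for n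
    proof (induction n)
      case 0
      then show ?case using DS quot_b by (auto intro: continuous_on_id simp: id_def)
    next
      case (Suc n)
      have "continuous_on ?D (\<lambda>c. T ((T ^^ n) c))"
        using Suc by (intro continuous_on_compose2[OF T(3)]) auto
      moreover have "T ((T ^^ n) c) \<in> ?S \<and> (c e = 0 \<longrightarrow> T ((T ^^ n) c) = c) \<and>
          quot (T ((T ^^ n) c)) - a \<le> (1 - \<kappa>) ^ Suc n * (b - a)" if c: "c \<in> ?D" for c
      proof (intro conjI impI)
        let ?d = "(T ^^ n) c"
        have d: "?d \<in> ?S" "c e = 0 \<longrightarrow> ?d = c" "quot ?d - a \<le> (1 - \<kappa>) ^ n * (b - a)"
          using Suc c by auto
        show "T ?d \<in> ?S" using d(1) T(4) by blast
        show "T ?d = c" if "c e = 0"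
          using that d T(5)[of c] quot_0[OF c] a DS c by auto
        have db: "quot ?d \<le> b"
        proof -
          have "(1 - \<kappa>) ^ n \<le> 1" using T by (simp add: power_le_one)
          then have "(1 - \<kappa>) ^ n * (b - a) \<le> 1 * (b - a)" using ab by (intro mult_right_mono) auto
          then have "quot ?d - a \<le> b - a" using order_trans[OF d(3)] by simp
          then show ?thesis by simp
        qed
        show "quot (T ?d) - a \<le> (1 - \<kappa>) ^ Suc n * (b - a)"
        proof (cases "quot ?d \<le> a")
          case True
          then have "quot (T ?d) - a \<le> 0" using T(5)[OF d(1)] by simp
          also have "0 \<le> (1 - \<kappa>) ^ Suc n * (b - a)" using T ab by simp
          finally show ?thesis .
        next
          case False
          then have "quot (T ?d) - a \<le> (1 - \<kappa>) * (quot ?d - a)" using T(6)[OF d(1)] db by simp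
          also have "\<dots> \<le> (1 - \<kappa>) * ((1 - \<kappa>) ^ n * (b - a))"
            using d(3) T by (intro mult_left_mono) auto
          finally show ?thesis by (simp add: mult.assoc)
        qed
      qed
      ultimately show ?case by (simp add: comp_def)
    qed
    \<comment> \<open>As soon as the gap is smaller than \<open>a\<close>, the whole image lies
      below level \<open>2 * a\<close>, where no linked point can be.\<close>
    have "(\<lambda>n. (1 - \<kappa>) ^ n * (b - a)) \<longlonglongrightarrow> 0 * (b - a)"
      using T by (intro tendsto_intros LIMSEQ_power_zero) auto
    then have "eventually (\<lambda>n. (1 - \<kappa>) ^ n * (b - a) < a) sequentially"
      using a by (intro order_tendstoD(2)) auto
    then obtain n where n: "(1 - \<kappa>) ^ n * (b - a) < a"
      by (auto simp: eventually_sequentially)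
    obtain c where c: "c \<in> ?D" "\<forall>i\<in>K. (T ^^ n) c i = 0"
      using half_sphere_linking[OF K(1,2), of "T ^^ n"] iter[of n] by auto
    then have "2 * a \<le> quot ((T ^^ n) c)" using iter[of n] by (intro quot_2a) auto
    then show False using iter[of n] c(1) n by force
  qed
  then obtain c where c: "c \<in> ?S" "a \<le> quot c" "quot c \<le> b" "\<forall>i\<in>I. residual c i = 0" by blast
  show ?thesis
    by (rule that[of c "quot c"]) (use c in \<open>auto simp: a_def b_def residual_def\<close>)
qed

end

section \<open>Completeness of the Fourier modes\<close>

definition fourier_char :: "int \<Rightarrow> real \<Rightarrow> complex" where
  "fourier_char k t = cis (2 * pi * of_int k * t)"

lemma fourier_char_add: "fourier_char (j + k) t = fourier_char j t * fourier_char k t"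
  by (simp add: fourier_char_def cis_mult algebra_simps)

lemma fourier_char_0 [simp]: "fourier_char k 0 = 1" "fourier_char 0 t = 1"
  by (simp_all add: fourier_char_def)

lemma fourier_char_1 [simp]: "fourier_char k 1 = 1"
  using cis_multiple_2pi[of "of_int k"] by (simp add: fourier_char_def mult_ac)

lemma has_vector_derivative_cis:
  "((\<lambda>t. cis (a * t)) has_vector_derivative (\<i> * of_real a * cis (a * t))) (at t within A)"
  unfolding has_vector_derivative_def
  by (auto intro!: derivative_eq_intros simp: fun_eq_iff scaleR_conv_of_real)

lemma has_vector_derivative_fourier_char:
  "(fourier_char k has_vector_derivative (2 * pi * \<i> * of_int k * fourier_char k t)) (at t within A)"
proof -
  have "(fourier_char k has_vector_derivative (\<i> * of_real (2 * pi * of_int k) * fourier_char k t)) (at t within A)"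
    unfolding fourier_char_def[abs_def] by (rule has_vector_derivative_cis)
  moreover have "\<i> * of_real (2 * pi * of_int k) = 2 * pi * \<i> * of_int k" by simp
  ultimately show ?thesis by metis
qed

lemma continuous_on_fourier_char [continuous_intros]: "continuous_on A (fourier_char k)"
  by (rule continuous_on_vector_derivative[OF has_vector_derivative_fourier_char])

lemma integral_fourier_char:
  assumes "k \<noteq> 0"
  shows "integral {0..1} (fourier_char k) = 0"
proof -
  have "((\<lambda>t. fourier_char k t / (2 * pi * \<i> * of_int k)) has_vector_derivative fourier_char k t)
      (at t within {0..1})" for t
    using has_vector_derivative_divide[OF has_vector_derivative_fourier_char[of k t "{0..1}"], of "2 * pi * \<i> * complex_of_int k"]
      assms by simp
  then have "(fourier_char k has_integral
      fourier_char k 1 / (2 * pi * \<i> * of_int k) - fourier_char k 0 / (2 * pi * \<i> * of_int k)) {0..1}"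
    by (intro fundamental_theorem_of_calculus) auto
  then show ?thesis by (simp add: integral_unique)
qed

definition fourier_null :: "(real \<Rightarrow> complex) \<Rightarrow> bool" where
  "fourier_null U \<longleftrightarrow> continuous_on {0..1} U \<and> (\<forall>k. integral {0..1} (\<lambda>t. U t * fourier_char k t) = 0)"

lemma fourier_null_add:
  assumes "fourier_null U" "fourier_null V"
  shows "fourier_null (\<lambda>t. U t + V t)"
proof -
  have "integral {0..1} (\<lambda>t. U t * fourier_char k t + V t * fourier_char k t) =
      integral {0..1} (\<lambda>t. U t * fourier_char k t) + integral {0..1} (\<lambda>t. V t * fourier_char k t)" for k
    using assms by (intro integral_add integrable_continuous_real continuous_intros) (auto simp: fourier_null_def)
  then show ?thesis
    using assms by (auto simp: fourier_null_def distrib_right intro!: continuous_intros)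
qed

lemma fourier_null_cmult:
  assumes "fourier_null U"
  shows "fourier_null (\<lambda>t. c * U t)"
  using assms by (auto simp: fourier_null_def mult.assoc intro!: continuous_intros)

lemma fourier_null_char:
  assumes "fourier_null U"
  shows "fourier_null (\<lambda>t. U t * fourier_char k t)"
  using assms by (auto simp: fourier_null_def mult.assoc intro!: continuous_intros simp flip: fourier_char_add)

text \<open>Multiplying by a character only shifts the coefficients, so \<open>fourier_null\<close>
  survives multiplication by the real and imaginary parts of \<open>fourier_char 1\<close>, hence by
  polynomials in them. The product case applies both hypotheses in turn and needs \<open>U\<close>
  arbitrary.\<close>

lemma fourier_null_real_polynomial:
  assumes "real_polynomial_function p" "fourier_null U"
  shows "fourier_null (\<lambda>t. U t * of_real (p (fourier_char 1 t)))"
  using assms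
proof (induction arbitrary: U rule: real_polynomial_function.induct)
  case (linear f)
  then interpret bounded_linear f by simp
  have f: "f z = Re z * f 1 + Im z * f \<i>" for z
  proof -
    have "z = Re z *\<^sub>R 1 + Im z *\<^sub>R \<i>" by (simp add: complex_eq_iff)
    then have "f z = f (Re z *\<^sub>R 1 + Im z *\<^sub>R \<i>)" by simp
    then show ?thesis by (simp only: add scaleR) simp
  qed
  have "fourier_char (- 1) t = cnj (fourier_char 1 t)" for t
    by (simp add: fourier_char_def cis_cnj)
  then have "of_real (Re (fourier_char 1 t)) = (fourier_char 1 t + fourier_char (- 1) t) / 2"
    "of_real (Im (fourier_char 1 t)) = (fourier_char 1 t - fourier_char (- 1) t) / (2 * \<i>)" for t
    by (simp_all add: complex_eq_iff)
  then have "U t * of_real (f (fourier_char 1 t)) =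
      (f 1 / 2 + f \<i> / (2 * \<i>)) * (U t * fourier_char 1 t) +
      (f 1 / 2 - f \<i> / (2 * \<i>)) * (U t * fourier_char (- 1) t)" for t
    by (subst f, unfold of_real_add of_real_mult) (simp only:, simp add: field_simps)
  moreover have "fourier_null (\<lambda>t. (f 1 / 2 + f \<i> / (2 * \<i>)) * (U t * fourier_char 1 t) +
      (f 1 / 2 - f \<i> / (2 * \<i>)) * (U t * fourier_char (- 1) t))"
    by (intro fourier_null_add fourier_null_cmult fourier_null_char \<open>fourier_null U\<close>)
  ultimately show ?case by presburger
next
  case (const c)
  then show ?case using fourier_null_cmult[of U "of_real c"] by (simp add: mult.commute)
next
  case (add f g)
  show ?case
    using fourier_null_add[OF add.IH(1)[OF add.prems] add.IH(2)[OF add.prems]] by (simp add: distrib_left)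
next
  case (mult f g)
  show ?case
    using mult.IH(2)[OF mult.IH(1)[OF mult.prems]] by (simp add: mult.assoc)
qed

text \<open>Equal end values let \<open>U\<close> descend to the circle, where Stone-Weierstrass
  provides polynomials \<open>p\<close> within \<open>e\<close>. As \<open>U\<close> is orthogonal
  to \<open>p\<close>, the integral of |U|^2 equals that of \<open>U * cnj (U - p)\<close> and is at
  most \<open>e * n\<close>.\<close>

lemma fourier_null_imp_zero:
  assumes U: "fourier_null U" "U 0 = U 1" and t: "t \<in> {0..1}"
  shows "U t = 0"
proof -
  have cU: "continuous_on {0..1} U" using U(1) by (simp add: fourier_null_def)
  define n where "n = integral {0..1} (\<lambda>t. norm (U t))"
  have n: "n \<ge> 0" unfolding n_def
    by (intro integral_nonneg integrable_continuous_real continuous_intros cU) auto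
  define f where "f = U \<circ> (\<lambda>z. Arg2pi z / (2 * pi))"
  \<comment> \<open>Used only to extract continuity of \<open>f\<close> across the branch cut of
    \<open>Arg2pi\<close>.\<close>
  have "homotopic_loops UNIV U U"
    using U(2) cU by (simp add: homotopic_loops_refl path_def pathstart_def pathfinish_def)
  then have cf: "continuous_on (sphere 0 1) f"
    using homotopic_loops_imp_homotopic_circlemaps homotopic_with_imp_continuous
    unfolding f_def by blast
  have fU: "f (fourier_char 1 t) = U t" if "t \<in> {0..1}" for t
  proof (cases "t = 1")
    case True
    then show ?thesis using U(2) Arg2pi_of_real[of 1] by (simp add: f_def)
  next
    case False
    have "Arg2pi (fourier_char 1 t) = 2 * pi * t"
      using that False by (intro Arg2pi_unique[of 1]) (auto simp: fourier_char_def cis_conv_exp)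
    then show ?thesis by (simp add: f_def)
  qed
  have sph: "fourier_char k t \<in> sphere 0 1" for k t by (simp add: fourier_char_def)
  have small: "integral {0..1} (\<lambda>t. (norm (U t))\<^sup>2) \<le> e * n" if e: "e > 0" for e
  proof -
    obtain g where g: "polynomial_function g" "\<And>z. z \<in> sphere 0 1 \<Longrightarrow> norm (f z - g z) < e"
      using Stone_Weierstrass_polynomial_function[OF compact_sphere cf e] by blast
    define p where "p t = g (fourier_char 1 t)" for t
    have pRe: "real_polynomial_function (Re \<circ> g)" and pIm: "real_polynomial_function (Im \<circ> g)"
      using g(1) bounded_linear_Re bounded_linear_Im by (auto simp: polynomial_function_def)
    have "fourier_null (\<lambda>t. U t * of_real ((Re \<circ> g) (fourier_char 1 t)) +
        (- \<i>) * (U t * of_real ((Im \<circ> g) (fourier_char 1 t))))"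
      by (intro fourier_null_add fourier_null_cmult fourier_null_real_polynomial pRe pIm U)
    moreover have "U t * of_real ((Re \<circ> g) (fourier_char 1 t)) +
        (- \<i>) * (U t * of_real ((Im \<circ> g) (fourier_char 1 t))) = U t * cnj (p t)" for t
      by (simp add: p_def complex_eq_iff algebra_simps)
    ultimately have null: "fourier_null (\<lambda>t. U t * cnj (p t))" by simp
    then have i0: "integral {0..1} (\<lambda>t. U t * cnj (p t)) = 0"
      using fourier_char_0(2) by (auto simp: fourier_null_def dest: spec[of _ 0])
    have c: "continuous_on {0..1} (\<lambda>t. U t * cnj (p t))"
      using null by (simp add: fourier_null_def)
    have c2: "continuous_on {0..1} (\<lambda>t. U t * cnj (U t))"
      by (intro continuous_intros cU)
    have "integral {0..1} (\<lambda>t. U t * cnj (U t)) = integral {0..1} (\<lambda>t. U t * cnj (U t) - U t * cnj (p t))"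
      using i0 by (subst integral_diff) (auto intro!: integrable_continuous_real c c2)
    also have "norm \<dots> \<le> integral {0..1} (\<lambda>t. e * norm (U t))"
    proof (rule integral_norm_bound_integral)
      fix t :: real assume t: "t \<in> {0..1}"
      have "norm (U t * cnj (U t) - U t * cnj (p t)) = norm (U t) * norm (U t - p t)"
        by (metis complex_cnj_diff complex_mod_cnj norm_mult right_diff_distrib)
      also have "\<dots> \<le> norm (U t) * e"
        using g(2)[OF sph, of 1 t] fU[OF t] by (intro mult_left_mono) (auto simp: p_def)
      finally show "norm (U t * cnj (U t) - U t * cnj (p t)) \<le> e * norm (U t)" by (simp add: mult.commute)
    qed (intro integrable_continuous_real continuous_intros c c2 cU)+
    also have "\<dots> = e * n" by (simp add: n_def)
    finally have le: "norm (integral {0..1} (\<lambda>t. U t * cnj (U t))) \<le> e * n" .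
    have "((\<lambda>t. complex_of_real ((norm (U t))\<^sup>2)) has_integral
        of_real (integral {0..1} (\<lambda>t. (norm (U t))\<^sup>2))) {0..1}"
      by (intro has_integral_of_real integrable_integral integrable_continuous_real continuous_intros cU)
    then have "integral {0..1} (\<lambda>t. U t * cnj (U t)) = of_real (integral {0..1} (\<lambda>t. (norm (U t))\<^sup>2))"
      by (simp add: integral_unique flip: complex_norm_square)
    then show ?thesis using le by simp
  qed
  have "integral {0..1} (\<lambda>t. (norm (U t))\<^sup>2) \<le> 0"
  proof (rule field_le_epsilon)
    fix e :: real assume e: "e > 0"
    \<comment> \<open>Dividing by \<open>n + 1\<close> covers the case \<open>n = 0\<close>.\<close>
    have "e / (n + 1) * n \<le> e" using n e by (simp add: field_simps)
    then show "integral {0..1} (\<lambda>t. (norm (U t))\<^sup>2) \<le> 0 + e"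
      using small[of "e / (n + 1)"] e n by simp
  qed
  moreover have "integral {0..1} (\<lambda>t. (norm (U t))\<^sup>2) \<ge> 0"
    by (intro integral_nonneg integrable_continuous_real continuous_intros cU) auto
  ultimately have "integral {0..1} (\<lambda>t. (norm (U t))\<^sup>2) = 0" by simp
  then have "\<forall>t\<in>{0..1}. (norm (U t))\<^sup>2 = 0"
    by (subst (asm) integral_eq_0_iff) (auto intro!: continuous_intros cU)
  then show ?thesis using t by simp
qed

text \<open>A periodic weak derivative that is continuous is a classical one. With \<open>W\<close>
  the primitive of \<Gamma>, integration by parts shows that \<open>X\<close> and \<open>W\<close>
  share all coefficients of nonzero frequency; after subtraction of the mean the difference has none
  left and vanishes.\<close>

lemma fourier_antiderivative:
  assumes cX: "continuous_on {0..1} X" and c\<Gamma>: "continuous_on {0..1} \<Gamma>" and X01: "X 0 = X 1"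
    and coeff: "\<And>k. - (2 * pi * \<i> * of_int k) * integral {0..1} (\<lambda>t. X t * fourier_char k t) =
      integral {0..1} (\<lambda>t. \<Gamma> t * fourier_char k t)"
    and t: "t \<in> {0..1}"
  shows "(X has_vector_derivative \<Gamma> t) (at t within {0..1})"
proof -
  define W where "W t = integral {0..t} \<Gamma>" for t
  have dW: "(W has_vector_derivative \<Gamma> t) (at t within {0..1})" if "t \<in> {0..1}" for t
    unfolding W_def[abs_def] using integral_has_vector_derivative[OF c\<Gamma> that] .
  have cW: "continuous_on {0..1} W"
    using dW continuous_on_vector_derivative by blast
  have W0: "W 0 = 0" by (simp add: W_def)
  \<comment> \<open>Frequency 0 says that \<Gamma> has mean zero, so \<open>W\<close> is periodic
    and the boundary terms drop out.\<close>
  have W1: "W 1 = 0" using coeff[of 0] by (simp add: W_def)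
  have parts: "integral {0..1} (\<lambda>t. \<Gamma> t * fourier_char k t) =
      - (2 * pi * \<i> * of_int k) * integral {0..1} (\<lambda>t. W t * fourier_char k t)" for k
  proof -
    have "((\<lambda>t. W t * (2 * pi * \<i> * of_int k * fourier_char k t) + \<Gamma> t * fourier_char k t) has_integral
        W 1 * fourier_char k 1 - W 0 * fourier_char k 0) {0..1}"
      by (intro fundamental_theorem_of_calculus has_vector_derivative_mult dW
          has_vector_derivative_fourier_char) auto
    then have "0 = integral {0..1} (\<lambda>t. W t * (2 * pi * \<i> * of_int k * fourier_char k t) + \<Gamma> t * fourier_char k t)"
      by (simp add: W0 W1 integral_unique)
    also have "\<dots> = integral {0..1} (\<lambda>t. (2 * pi * \<i> * of_int k) * (W t * fourier_char k t)) +
        integral {0..1} (\<lambda>t. \<Gamma> t * fourier_char k t)"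
      by (subst integral_add[symmetric])
         (auto intro!: integrable_continuous_real continuous_intros cW c\<Gamma> simp: mult_ac)
    finally show ?thesis by (simp add: eq_neg_iff_add_eq_0 add.commute)
  qed
  define m where "m = integral {0..1} (\<lambda>t. X t - W t)"
  define U where "U t = X t - W t - m" for t
  have cU: "continuous_on {0..1} U"
    unfolding U_def[abs_def] by (intro continuous_intros cX cW)
  have "integral {0..1} (\<lambda>t. U t * fourier_char k t) = 0" for k
  proof -
    have "integral {0..1} (\<lambda>t. U t * fourier_char k t) =
        integral {0..1} (\<lambda>t. X t * fourier_char k t - W t * fourier_char k t - m * fourier_char k t)"
      by (simp add: U_def algebra_simps)
    also have "\<dots> = integral {0..1} (\<lambda>t. X t * fourier_char k t) - integral {0..1} (\<lambda>t. W t * fourier_char k t)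
        - m * integral {0..1} (fourier_char k)"
      by (simp add: integral_diff integrable_continuous_real continuous_intros cX cW)
    also have "\<dots> = 0"
    proof (cases "k = 0")
      case True
      then show ?thesis
        by (simp add: m_def integral_diff integrable_continuous_real cX cW fourier_char_0[abs_def])
    next
      case False
      then show ?thesis using coeff[of k] parts[of k] by (simp add: integral_fourier_char)
    qed
    finally show ?thesis .
  qed
  then have "fourier_null U" using cU by (simp add: fourier_null_def)
  moreover have "U 0 = U 1" using X01 W0 W1 by (simp add: U_def)
  ultimately have "U t = 0" if "t \<in> {0..1}" for t
    using that by (rule fourier_null_imp_zero)
  then have X: "X s = W s + m" if "s \<in> {0..1}" for s
    using that by (force simp: U_def algebra_simps)
  have "((\<lambda>s. W s + m) has_vector_derivative \<Gamma> t) (at t within {0..1})"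
    using dW[OF t] by (auto intro!: derivative_eq_intros)
  then show ?thesis
    using X t by (auto intro: has_vector_derivative_transform)
qed

section \<open>Twisted modes\<close>

definition cmul_i :: "complex ^ 'n::finite \<Rightarrow> complex ^ 'n" where
  "cmul_i v = (\<chi> j. \<i> * v $ j)"

lemma norm_cmul_i [simp]: "norm (cmul_i v) = norm v"
  by (simp add: norm_vec_def cmul_i_def norm_mult)

lemma linear_cmul_i: "linear cmul_i"
  by (rule linearI) (auto simp: cmul_i_def vec_eq_iff distrib_left)

lemma continuous_on_cmul_i [continuous_intros]:
  "continuous_on A f \<Longrightarrow> continuous_on A (\<lambda>x. cmul_i (f x))"
  by (rule continuous_on_compose2[OF linear_continuous_on[OF linear_conv_bounded_linear[THEN iffD1, OF linear_cmul_i], of UNIV]]) auto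

text \<open>The index \<open>(j, k, b)\<close> stands for the coordinate \<open>j\<close>, the integer frequency \<open>k\<close> and one of the two real
  directions \<open>1\<close> and \<open>\<i>\<close> of \<open>\<complex>\<close>.\<close>

definition twisted_freq :: "('n \<Rightarrow> real) \<Rightarrow> 'n \<times> int \<times> bool \<Rightarrow> real" where
  "twisted_freq \<theta> = (\<lambda>(j, k, b). 2 * pi * (of_int k + \<theta> j))"

text \<open>The eigenfunctions of -i d/dt under the boundary condition
  \<open>x 1 = twist \<theta> (x 0)\<close>, with eigenvalue \<open>twisted_freq\<close>.\<close>

definition twisted_mode :: "('n \<Rightarrow> real) \<Rightarrow> 'n \<times> int \<times> bool \<Rightarrow> real \<Rightarrow> complex ^ 'n::finite" where
  "twisted_mode \<theta> = (\<lambda>(j, k, b) t. axis j (cis (2 * pi * (of_int k + \<theta> j) * t) * (if b then 1 else \<i>)))"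

definition twist :: "('n \<Rightarrow> real) \<Rightarrow> complex ^ 'n::finite \<Rightarrow> complex ^ 'n" where
  "twist \<theta> v = (\<chi> j. cis (2 * pi * \<theta> j) * v $ j)"

lemma norm_twist [simp]: "norm (twist \<theta> v) = norm v"
  by (simp add: norm_vec_def twist_def norm_mult)

lemma linear_twist: "linear (twist \<theta>)"
  by (rule linearI) (auto simp: twist_def vec_eq_iff distrib_left)

lemma has_vector_derivative_axis:
  assumes "(f has_vector_derivative f') F"
  shows "((\<lambda>t. axis j (f t)) has_vector_derivative (axis j f' :: 'a::real_normed_vector ^ 'n::finite)) F"
proof -
  have "bounded_linear (axis j :: 'a \<Rightarrow> 'a ^ 'n)"
  proof (rule bounded_linear_intro[of _ 1])
    fix x y :: 'a and r :: real
    show "axis j (x + y) = axis j x + (axis j y :: 'a ^ 'n)" by (simp add: axis_def vec_eq_iff)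
    show "axis j (r *\<^sub>R x) = r *\<^sub>R (axis j x :: 'a ^ 'n)" by (simp add: axis_def vec_eq_iff)
    show "norm (axis j x :: 'a ^ 'n) \<le> norm x * 1" by (simp add: norm_vec_def L2_set_def axis_def if_distrib[of norm] if_distrib[of "\<lambda>x. x\<^sup>2"] cong: if_cong)
  qed
  then show ?thesis using assms by (rule bounded_linear.has_vector_derivative)
qed

lemma has_vector_derivative_twisted_mode:
  "(twisted_mode \<theta> i has_vector_derivative twisted_freq \<theta> i *\<^sub>R cmul_i (twisted_mode \<theta> i t)) (at t within A)"
proof (cases i)
  case (fields j k b)
  have "((\<lambda>t. axis j (cis (2 * pi * (of_int k + \<theta> j) * t) * (if b then 1 else \<i>))) has_vector_derivative
      (axis j (\<i> * of_real (2 * pi * (of_int k + \<theta> j)) * cis (2 * pi * (of_int k + \<theta> j) * t) * (if b then 1 else \<i>))))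
      (at t within A)"
    by (intro has_vector_derivative_axis has_vector_derivative_mult_left has_vector_derivative_cis)
  moreover have "axis j (\<i> * of_real (2 * pi * (of_int k + \<theta> j)) * cis (2 * pi * (of_int k + \<theta> j) * t) * (if b then 1 else \<i>))
      = twisted_freq \<theta> i *\<^sub>R cmul_i (twisted_mode \<theta> i t)"
    by (auto simp: fields twisted_freq_def twisted_mode_def cmul_i_def vec_eq_iff axis_def)
       (simp_all add: scaleR_conv_of_real)
  ultimately show ?thesis by (simp add: fields twisted_mode_def)
qed

lemma continuous_on_twisted_mode: "continuous_on A (twisted_mode \<theta> i)"
  by (rule continuous_on_vector_derivative[OF has_vector_derivative_twisted_mode])

lemma twisted_mode_period: "twisted_mode \<theta> i (t + 1) = twist \<theta> (twisted_mode \<theta> i t)"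
proof (cases i)
  case (fields j k b)
  have "cis (2 * pi * (of_int k + \<theta> j) * (t + 1)) =
      cis (2 * pi * (of_int k + \<theta> j) * t) * cis (2 * pi * of_int k) * cis (2 * pi * \<theta> j)"
    by (simp add: cis_mult algebra_simps)
  also have "cis (2 * pi * of_int k) = 1" using cis_multiple_2pi[of "of_int k"] by simp
  finally have "cis (2 * pi * (of_int k + \<theta> j) * (t + 1)) = cis (2 * pi * \<theta> j) * cis (2 * pi * (of_int k + \<theta> j) * t)"
    by simp
  then show ?thesis
    by (auto simp: fields twisted_mode_def twist_def vec_eq_iff axis_def)
qed

lemma twisted_mode_orthonormal:
  "integral {0..1} (\<lambda>t. twisted_mode \<theta> i t \<bullet> twisted_mode \<theta> i' t) = (if i = i' then 1 else 0)"
proof (cases i; cases i')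
  fix j k b j' k' b' assume i: "i = (j, k, b)" "i' = (j', k', b')"
  show ?thesis
  proof (cases "j = j'")
    case False
    then show ?thesis by (simp add: i twisted_mode_def inner_axis_axis)
  next
    case True
    \<comment> \<open>The real inner product is the real part of the Hermitian one. The angle
      \<theta> cancels, and for equal frequencies \<open>d\<close> has real part 1 or 0 according to
      whether the two directions agree.\<close>
    define d where "d = (if b then 1 else \<i>) * cnj (if b' then 1 else \<i>)"
    have "twisted_mode \<theta> i t \<bullet> twisted_mode \<theta> i' t = Re (fourier_char (k - k') t * d)" for t
    proof -
      have *: "cis (2 * pi * (of_int k + \<theta> j) * t) * cnj (cis (2 * pi * (of_int k' + \<theta> j) * t)) = fourier_char (k - k') t"
        by (simp add: cis_cnj cis_mult fourier_char_def algebra_simps)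
      have "Re (fourier_char (k - k') t * d) = Re ((cis (2 * pi * (of_int k + \<theta> j) * t) * (if b then 1 else \<i>)) *
         cnj (cis (2 * pi * (of_int k' + \<theta> j) * t) * (if b' then 1 else \<i>)))"
        unfolding *[symmetric] d_def complex_cnj_mult by (simp only: mult_ac)
      also have "\<dots> = twisted_mode \<theta> i t \<bullet> twisted_mode \<theta> i' t"
        using True by (simp add: i twisted_mode_def inner_axis_axis inner_complex_def)
      finally show ?thesis by simp
    qed
    then have "integral {0..1} (\<lambda>t. twisted_mode \<theta> i t \<bullet> twisted_mode \<theta> i' t) =
        integral {0..1} (\<lambda>t. Re (fourier_char (k - k') t * d))" by simp
    also have "\<dots> = Re (integral {0..1} (\<lambda>t. fourier_char (k - k') t * d))"
      by (intro integral_linear[OF _ bounded_linear_Re, unfolded o_def] integrable_continuous_real continuous_intros)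
    also have "\<dots> = Re (integral {0..1} (fourier_char (k - k')) * d)" by simp
    also have "\<dots> = (if i = i' then 1 else 0)"
    proof (cases "k = k'")
      case False
      then show ?thesis by (simp add: integral_fourier_char i)
    next
      case k: True
      have "fourier_char 0 = (\<lambda>t. 1)" by (simp add: fun_eq_iff)
      then show ?thesis using k True by (auto simp: i d_def)
    qed
    finally show ?thesis .
  qed
qed

text \<open>The two real modes of one frequency together carry one complex Fourier coefficient; this
  leads back from the real orthonormal system to complex Fourier theory.\<close>

lemma twisted_mode_coeff:
  fixes v :: "complex ^ 'n::finite"
  shows "of_real (v \<bullet> twisted_mode \<theta> (j, k, True) t) + \<i> * of_real (v \<bullet> twisted_mode \<theta> (j, k, False) t) =
    v $ j * cis (- (2 * pi * (of_int k + \<theta> j) * t))"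
proof -
  have "of_real (z \<bullet> (cis a * 1)) + \<i> * of_real (z \<bullet> (cis a * \<i>)) = z * cis (- a)" for z a
    by (simp add: inner_complex_def complex_eq_iff)
  then show ?thesis
    by (simp add: twisted_mode_def inner_axis)
qed

section \<open>The limit of the approximate orbits\<close>

text \<open>Young's inequality under the integral, with \<eta> left free; the best \<eta> would give
  the usual Hoelder bound of exponent 1/2.\<close>

lemma increment_bound_of_dirichlet_energy:
  fixes x :: "real \<Rightarrow> 'a::euclidean_space"
  assumes d: "\<And>t. t \<in> {0..1} \<Longrightarrow> (x has_vector_derivative x' t) (at t within {0..1})"
    and c: "continuous_on {0..1} x'" and B: "integral {0..1} (\<lambda>t. (norm (x' t))\<^sup>2) \<le> B"
    and \<eta>: "0 < \<eta>" and st: "s \<in> {0..1}" "t \<in> {0..1}"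
  shows "norm (x t - x s) \<le> \<bar>t - s\<bar> / (2 * \<eta>) + \<eta> * B / 2"
proof -
  have *: "norm (x t - x s) \<le> \<bar>t - s\<bar> / (2 * \<eta>) + \<eta> * B / 2" if "s \<le> t" "s \<in> {0..1}" "t \<in> {0..1}" for s t
  proof -
    have sub: "{s..t} \<subseteq> {0..1}" using that by auto
    have c': "continuous_on {s..t} x'" using c sub continuous_on_subset by blast
    have "(x' has_integral (x t - x s)) {s..t}"
      using d sub by (intro fundamental_theorem_of_calculus that(1))
        (meson has_vector_derivative_within_subset subset_iff)
    then have "norm (x t - x s) = norm (integral {s..t} x')" by (simp add: integral_unique)
    also have "\<dots> \<le> integral {s..t} (\<lambda>r. 1 / (2 * \<eta>) + \<eta> / 2 * (norm (x' r))\<^sup>2)"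
    proof (rule integral_norm_bound_integral)
      fix r
      have "0 \<le> (\<eta> * norm (x' r) - 1)\<^sup>2 / (2 * \<eta>)" using \<eta> by simp
      also have "\<dots> = 1 / (2 * \<eta>) + \<eta> / 2 * (norm (x' r))\<^sup>2 - norm (x' r)"
        using \<eta> by (simp add: field_simps power2_eq_square)
      finally show "norm (x' r) \<le> 1 / (2 * \<eta>) + \<eta> / 2 * (norm (x' r))\<^sup>2" by simp
    qed (intro integrable_continuous_real continuous_intros c')+
    also have "\<dots> = (t - s) / (2 * \<eta>) + \<eta> / 2 * integral {s..t} (\<lambda>r. (norm (x' r))\<^sup>2)"
      using that(1) by (subst integral_add) (auto intro!: integrable_continuous_real continuous_intros c')
    also have "integral {s..t} (\<lambda>r. (norm (x' r))\<^sup>2) \<le> integral {0..1} (\<lambda>r. (norm (x' r))\<^sup>2)"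
      by (intro integral_subset_le sub integrable_continuous_real continuous_intros c c') auto
    then have "\<eta> / 2 * integral {s..t} (\<lambda>r. (norm (x' r))\<^sup>2) \<le> \<eta> / 2 * B"
      using B \<eta> by (intro mult_left_mono) auto
    finally show ?thesis using that(1) by simp
  qed
  show ?thesis
    using *[OF _ st] *[OF _ st(2,1)] by (cases "s \<le> t") (simp_all add: norm_minus_commute abs_minus_commute)
qed

text \<open>\<open>w\<close> bounds all positive frequencies at once, so that the lower bound on
  critical values does not depend on the cutoff.\<close>

locale twisted_hamiltonian = quadratic_hamiltonian H G
  for H :: "complex ^ 'n::finite \<Rightarrow> real" and G +
  fixes \<theta> :: "'n \<Rightarrow> real" and w :: real
  assumes w_pos: "0 < w" and gap: "0 < twisted_freq \<theta> i \<Longrightarrow> w \<le> twisted_freq \<theta> i"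
begin

abbreviation "modes N \<equiv> (UNIV :: 'n set) \<times> {- int N..int N} \<times> (UNIV :: bool set)"

text \<open>The weak form of x' = \<tau> i G(x) tested against one mode. No derivative of
  \<open>x\<close> occurs, so uniform limits pass through it.\<close>

definition stationary_coeff where
  "stationary_coeff x \<tau> i \<longleftrightarrow> twisted_freq \<theta> i * integral {0..1} (\<lambda>t. x t \<bullet> twisted_mode \<theta> i t) =
    \<tau> * integral {0..1} (\<lambda>t. G (x t) \<bullet> twisted_mode \<theta> i t)"

definition approx_orbit where
  "approx_orbit a b B N x x' \<tau> \<longleftrightarrow>
    (\<forall>t\<in>{0..1}. (x has_vector_derivative x' t) (at t within {0..1})) \<and> continuous_on {0..1} x' \<and>
    integral {0..1} (\<lambda>t. (norm (x t))\<^sup>2) = 1 \<and> integral {0..1} (\<lambda>t. (norm (x' t))\<^sup>2) \<le> B \<and>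
    a \<le> \<tau> \<and> \<tau> \<le> b \<and> x 1 = twist \<theta> (x 0) \<and> (\<forall>i\<in>modes N. stationary_coeff x \<tau> i)"

text \<open>The order of choice is the point: \<open>a\<close>, \<open>b\<close> and
  \<open>B\<close> come before \<open>N\<close>. The bound on the derivative follows from the
  equation itself, since \<open>G\<close> grows at most linearly and \<open>path c\<close> has unit
  norm in L^2.\<close>

lemma approx_orbit_exists:
  obtains a b B N0 where "0 < a" "\<And>N. N \<ge> N0 \<Longrightarrow> \<exists>x x' \<tau>. approx_orbit a b B N x x' \<tau>"
proof -
  obtain m M where mM: "0 < m" "0 < M" "\<And>z. m * (norm z)\<^sup>2 \<le> H z" "\<And>z. H z \<le> M * (norm z)\<^sup>2"
    by (rule H_bounds) blast
  obtain C where C: "0 \<le> C" "\<And>z. norm (G z) \<le> C * norm z"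
    by (rule G_bound) blast
  fix j0 :: 'n
  \<comment> \<open>Makes the frequency of \<open>e\<close> positive; \<open>e\<close> is the same
    mode for every cutoff from \<open>N0\<close> on, which fixes \<open>b\<close>.\<close>
  define k0 where "k0 = \<lceil>- \<theta> j0\<rceil> + 1"
  define e where "e = (j0, k0, True)"
  define N0 where "N0 = nat \<bar>k0\<bar>"
  have "of_int k0 + \<theta> j0 > 0" unfolding k0_def by linarith
  then have e: "twisted_freq \<theta> e > 0" by (simp add: e_def twisted_freq_def)
  define a where "a = w / (4 * M)"
  define b where "b = twisted_freq \<theta> e / (2 * m)"
  define B where "B = b\<^sup>2 * C\<^sup>2"
  have a: "a > 0" using w_pos mM by (simp add: a_def)
  have "\<exists>x x' \<tau>. approx_orbit a b B N x x' \<tau>" if N: "N \<ge> N0" for N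
  proof -
    interpret galerkin H G "twisted_mode \<theta>" "twisted_freq \<theta>" "modes N"
      by unfold_locales (auto simp: continuous_on_twisted_mode twisted_mode_orthonormal)
    have eN: "e \<in> modes N" using N by (auto simp: e_def N0_def)
    obtain c \<tau> where c: "c \<in> coord_sphere (modes N)" "a \<le> \<tau>" "\<tau> \<le> b"
      "\<And>i. i \<in> modes N \<Longrightarrow> twisted_freq \<theta> i * c i = \<tau> * integral {0..1} (\<lambda>t. G (path c t) \<bullet> twisted_mode \<theta> i t)"
      by (rule critical_point[OF eN e w_pos gap mM, folded a_def b_def]) (assumption, rule that, blast+)
    \<comment> \<open>\<open>y\<close> is -i times the derivative of \<open>path c\<close>, and
      \<open>S\<close> is its squared L^2 norm.\<close>
    define y where "y = path (\<lambda>i. twisted_freq \<theta> i * c i)"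
    define S where "S = (\<Sum>i\<in>modes N. (twisted_freq \<theta> i * c i)\<^sup>2)"
    have yS: "integral {0..1} (\<lambda>t. (norm (y t))\<^sup>2) = S"
      unfolding y_def S_def by (rule parseval_norm)
    have cy: "continuous_on {0..1} y" unfolding y_def by (rule cont_path)
    have nx: "integral {0..1} (\<lambda>t. (norm (path c t))\<^sup>2) = 1"
      using c(1) by (simp add: parseval_norm coord_sphere_def)
    have \<tau>: "0 < \<tau>" "\<tau>\<^sup>2 \<le> b\<^sup>2" using c a by (auto intro: power_mono)
    \<comment> \<open>Pairing the critical point equation with \<open>y\<close> bounds \<open>S\<close> by half of itself plus a constant.\<close>
    have "S = (\<Sum>i\<in>modes N. \<tau> * ((twisted_freq \<theta> i * c i) * integral {0..1} (\<lambda>t. G (path c t) \<bullet> twisted_mode \<theta> i t)))"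
      unfolding S_def by (intro sum.cong refl) (simp add: c(4) power2_eq_square)
    also have "\<dots> = \<tau> * integral {0..1} (\<lambda>t. G (path c t) \<bullet> y t)"
      by (simp add: y_def integral_inner_path cont_G_path sum_distrib_left)
    also have "\<dots> = integral {0..1} (\<lambda>t. \<tau> * (G (path c t) \<bullet> y t))" by simp
    also have "\<dots> \<le> integral {0..1} (\<lambda>t. (1/2) * (norm (y t))\<^sup>2 + (b\<^sup>2 * C\<^sup>2 / 2) * (norm (path c t))\<^sup>2)"
    proof (rule integral_le)
      fix t :: real
      have "\<tau> * (G (path c t) \<bullet> y t) = (\<tau> *\<^sub>R G (path c t)) \<bullet> y t" by simp
      also have "\<dots> \<le> norm (\<tau> *\<^sub>R G (path c t)) * norm (y t)" by (rule norm_cauchy_schwarz)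
      also have "\<dots> \<le> (norm (\<tau> *\<^sub>R G (path c t)))\<^sup>2 / 2 + (norm (y t))\<^sup>2 / 2"
        using sum_squares_bound[of "norm (\<tau> *\<^sub>R G (path c t))" "norm (y t)"] by simp
      also have "(norm (\<tau> *\<^sub>R G (path c t)))\<^sup>2 = \<tau>\<^sup>2 * (norm (G (path c t)))\<^sup>2"
        by (simp add: power_mult_distrib)
      also have "\<dots> \<le> b\<^sup>2 * (C * norm (path c t))\<^sup>2"
        using C \<tau> c(3) by (intro mult_mono power_mono) auto
      finally show "\<tau> * (G (path c t) \<bullet> y t) \<le> (1/2) * (norm (y t))\<^sup>2 + (b\<^sup>2 * C\<^sup>2 / 2) * (norm (path c t))\<^sup>2"
        by (simp add: power_mult_distrib mult_ac)
    qed (intro integrable_continuous_real continuous_intros cont_path cont_G_path cy)+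
    also have "\<dots> = (1/2) * S + (b\<^sup>2 * C\<^sup>2 / 2) * 1"
      by (subst integral_add) (auto intro!: integrable_continuous_real continuous_intros cont_path cy simp: yS nx)
    finally have SB: "S \<le> B" by (simp add: B_def)
    have "approx_orbit a b B N (path c) (\<lambda>t. cmul_i (y t)) \<tau>"
      unfolding approx_orbit_def
    proof (intro conjI ballI)
      fix t :: real
      have "(path c has_vector_derivative (\<Sum>i\<in>modes N. c i *\<^sub>R (twisted_freq \<theta> i *\<^sub>R cmul_i (twisted_mode \<theta> i t))))
          (at t within {0..1})"
        unfolding path_def[abs_def]
        by (intro has_vector_derivative_sum bounded_linear.has_vector_derivative[OF bounded_linear_scaleR_right] has_vector_derivative_twisted_mode)
      moreover have "(\<Sum>i\<in>modes N. c i *\<^sub>R (twisted_freq \<theta> i *\<^sub>R cmul_i (twisted_mode \<theta> i t))) = cmul_i (y t)"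
        by (simp add: y_def path_def linear_sum[OF linear_cmul_i] linear_scale[OF linear_cmul_i] mult.commute)
      ultimately show "(path c has_vector_derivative cmul_i (y t)) (at t within {0..1})" by simp
    next
      show "path c 1 = twist \<theta> (path c 0)"
        using twisted_mode_period[of \<theta> _ 0]
        by (simp add: path_def linear_sum[OF linear_twist] linear_scale[OF linear_twist])
    next
      fix i assume i: "i \<in> modes N"
      show "stationary_coeff (path c) \<tau> i"
        unfolding stationary_coeff_def integral_path_\<phi>[OF i] by (rule c(4)[OF i])
    qed (use c nx SB yS in \<open>auto intro!: continuous_intros cy\<close>)
    then show ?thesis by blast
  qed
  then show ?thesis using that a by blast
qed

text \<open>Uniform convergence of the paths and convergence of the multipliers suffice. The
  normalised L^2 norm passes to the limit and excludes the zero path.\<close>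

lemma weak_orbit_exists:
  obtains x \<tau> where "0 < \<tau>" "continuous_on {0..1} x" "x 1 = twist \<theta> (x 0)"
    "integral {0..1} (\<lambda>t. (norm (x t))\<^sup>2) = 1" "\<And>i. stationary_coeff x \<tau> i"
proof -
  obtain a b B N0 where a: "0 < a" and ex: "\<And>N. N \<ge> N0 \<Longrightarrow> \<exists>x x' \<tau>. approx_orbit a b B N x x' \<tau>"
    by (rule approx_orbit_exists) blast
  have "\<forall>n. \<exists>x x' \<tau>. approx_orbit a b B (N0 + n) x x' \<tau>" using ex by simp
  then obtain X X' T where X: "\<And>n. approx_orbit a b B (N0 + n) (X n) (X' n) (T n)" by metis
  have dX: "(X n has_vector_derivative X' n t) (at t within {0..1})" if "t \<in> {0..1}" for n t
    using X that by (auto simp: approx_orbit_def)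
  have cX': "continuous_on {0..1} (X' n)" and n1: "integral {0..1} (\<lambda>t. (norm (X n t))\<^sup>2) = 1"
    and BX: "integral {0..1} (\<lambda>t. (norm (X' n t))\<^sup>2) \<le> B" and T: "T n \<in> {a..b}"
    and per: "X n 1 = twist \<theta> (X n 0)"
    and st: "\<And>i. i \<in> modes (N0 + n) \<Longrightarrow> stationary_coeff (X n) (T n) i" for n
    using X[of n] by (auto simp: approx_orbit_def)
  have cX: "continuous_on {0..1} (X n)" for n
    using dX by (rule continuous_on_vector_derivative)
  have incr: "norm (X n t - X n s) \<le> \<bar>t - s\<bar> / (2 * \<eta>) + \<eta> * B / 2"
    if "\<eta> > 0" "s \<in> {0..1}" "t \<in> {0..1}" for n \<eta> s t
    using increment_bound_of_dirichlet_energy[OF dX cX' BX that] .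
  have B0: "B \<ge> 0"
  proof -
    have "0 \<le> integral {0..1} (\<lambda>t. (norm (X' 0 t))\<^sup>2)"
      by (intro integral_nonneg integrable_continuous_real continuous_intros cX') auto
    then show ?thesis using BX[of 0] by linarith
  qed
  \<comment> \<open>Unit L^2 norm forces norm at most 1 at some time; the increment bound with
    \<eta> = 1 carries this to all times.\<close>
  have bnd: "norm (X n t) \<le> 2 + B" if t: "t \<in> {0..1}" for n t
  proof (rule ccontr)
    assume neg: "\<not> norm (X n t) \<le> 2 + B"
    have "\<exists>s\<in>{0..1}. norm (X n s) \<le> 1"
    proof (rule ccontr)
      assume "\<not> ?thesis"
      then have gt: "\<And>s. s \<in> {0..1} \<Longrightarrow> 1 < norm (X n s)" by force
      have "integral {0..1} (\<lambda>s. (norm (X n s))\<^sup>2 - 1) = 0"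
        using n1[of n] by (subst integral_diff) (auto intro!: integrable_continuous_real continuous_intros cX)
      then have "\<forall>s\<in>{0..1}. (norm (X n s))\<^sup>2 - 1 = 0"
        using gt by (subst (asm) integral_eq_0_iff)
          (auto intro!: continuous_intros cX one_le_power less_imp_le)
      then have "(norm (X n 0))\<^sup>2 = 1" by simp
      moreover have "1 < (norm (X n 0))\<^sup>2" using gt[of 0] by (intro one_less_power) auto
      ultimately show False by simp
    qed
    then obtain s where s: "s \<in> {0..1}" "norm (X n s) \<le> 1" by blast
    have "\<bar>t - s\<bar> \<le> 1" using s t by auto
    then have "norm (X n t - X n s) \<le> 1 / 2 + B / 2" using incr[of 1 s t n] s t by simp
    then show False using neg s(2) norm_triangle_ineq2[of "X n t" "X n s"] B0 by linarith
  qed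
  have equi: "\<exists>d>0. \<forall>n y. y \<in> {0..1} \<and> norm (t - y) < d \<longrightarrow> norm (X n t - X n y) < \<epsilon>"
    if t: "t \<in> {0..1}" and \<epsilon>: "\<epsilon> > 0" for t \<epsilon>
  proof (intro exI conjI allI impI)
    \<comment> \<open>With this \<eta> and distance below \<open>\<epsilon> * \<eta>\<close>, each
      term of the increment bound is less than \<open>\<epsilon> / 2\<close>.\<close>
    define \<eta> where "\<eta> = \<epsilon> / (B + 1)"
    have \<eta>: "\<eta> > 0" "\<eta> * B < \<epsilon>" using \<epsilon> B0 by (auto simp: \<eta>_def field_simps)
    show "\<epsilon> * \<eta> > 0" using \<epsilon> \<eta> by simp
    fix n y assume y: "y \<in> {0..1} \<and> norm (t - y) < \<epsilon> * \<eta>"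
    then have "\<bar>t - y\<bar> / (2 * \<eta>) < \<epsilon> / 2" using \<eta> by (simp add: field_simps)
    then show "norm (X n t - X n y) < \<epsilon>" using incr[OF \<eta>(1), of y t n] y t \<eta> by simp
  qed
  have "\<exists>g k. continuous_on {0..1} g \<and> strict_mono (k :: nat \<Rightarrow> nat) \<and>
    (\<forall>e>0. \<exists>N. \<forall>n t. n \<ge> N \<and> t \<in> {0..1} \<longrightarrow> norm (X (k n) t - g t) < e)" (is ?AA)
  proof (rule Arzela_Ascoli[of "{0..1}" X "2 + B"])
    show ?AA if "continuous_on {0..1} g" "strict_mono k"
      "\<And>e. 0 < e \<Longrightarrow> \<exists>N. \<forall>n t. n \<ge> N \<and> t \<in> {0..1} \<longrightarrow> norm (X (k n) t - g t) < e" for g and k :: "nat \<Rightarrow> nat"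
      by (intro exI[of _ g] exI[of _ k] conjI allI impI that)
  qed (use bnd equi in auto)
  then obtain g k where g: "continuous_on {0..1} g" "strict_mono (k :: nat \<Rightarrow> nat)"
    "\<And>e. 0 < e \<Longrightarrow> \<exists>N. \<forall>n t. n \<ge> N \<and> t \<in> {0..1} \<longrightarrow> norm (X (k n) t - g t) < e"
    by blast
  obtain \<tau> r where \<tau>: "\<tau> \<in> {a..b}" and r: "strict_mono r" "((\<lambda>n. T (k n)) \<circ> r) \<longlonglongrightarrow> \<tau>"
    using compact_Icc[of a b, unfolded compact_def, rule_format, of "\<lambda>n. T (k n)"] T by blast
  define s where "s n = k (r n)" for n
  have s: "strict_mono s" using strict_mono_o[OF g(2) r(1)] by (simp add: s_def[abs_def] o_def)
  have Ts: "(\<lambda>n. T (s n)) \<longlonglongrightarrow> \<tau>" using r(2) by (simp add: s_def o_def)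
  have ul: "uniform_limit {0..1} (\<lambda>n. X (s n)) g sequentially"
  proof (rule uniform_limitI)
    fix e :: real assume "e > 0"
    then obtain N where N: "\<And>n x. n \<ge> N \<Longrightarrow> x \<in> {0..1} \<Longrightarrow> norm (X (k n) x - g x) < e" using g(3) by blast
    show "\<forall>\<^sub>F n in sequentially. \<forall>x\<in>{0..1}. dist (X (s n) x) (g x) < e"
      unfolding eventually_sequentially
    proof (intro exI allI impI ballI)
      fix n x assume "N \<le> n" "x \<in> {0..1::real}"
      then show "dist (X (s n) x) (g x) < e"
        using N[of "r n" x] seq_suble[OF r(1), of n] by (simp add: s_def dist_norm)
    qed
  qed
  have gb: "norm (g t) \<le> 2 + B" if t: "t \<in> {0..1}" for t
    using tendsto_uniform_limitI[OF ul t] bnd[OF t]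
    by (intro Lim_norm_ubound[of sequentially "\<lambda>n. X (s n) t"]) auto
  \<comment> \<open>All paths and the limit stay in one ball, on which \<open>f\<close> is uniformly
    continuous.\<close>
  have ulf: "uniform_limit {0..1} (\<lambda>n t. f (X (s n) t)) (\<lambda>t. f (g t)) sequentially"
    if "continuous_on UNIV f" for f :: "complex ^ 'n \<Rightarrow> 'z::metric_space"
    using uniform_limit_compose[OF ul, of "cball 0 (2 + B)" f] bnd gb
      compact_uniformly_continuous[OF continuous_on_subset[OF that] compact_cball]
    by (auto simp: o_def image_subset_iff intro!: always_eventually)
  have integral_lim: "(\<lambda>n. integral {0..1} (h n)) \<longlonglongrightarrow> integral {0..1} h'"
    if u: "uniform_limit {0..1} h h' sequentially" and c: "\<And>n. continuous_on {0..1} (h n)"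
    for h :: "nat \<Rightarrow> real \<Rightarrow> real" and h'
    using uniform_limit_integral[OF u c sequentially_bot] by (metis (no_types, lifting) ext integral_unique)
  have lim_inner: "(\<lambda>n. integral {0..1} (\<lambda>t. f (X (s n) t) \<bullet> twisted_mode \<theta> i t)) \<longlonglongrightarrow>
      integral {0..1} (\<lambda>t. f (g t) \<bullet> twisted_mode \<theta> i t)"
    if f: "continuous_on UNIV f" for f i
  proof (rule integral_lim)
    have bd: "bounded (h ` {0..1})" if "continuous_on {0..1} h" for h :: "real \<Rightarrow> complex ^ 'n"
      using that by (intro compact_imp_bounded compact_continuous_image) auto
    have "continuous_on {0..1} (\<lambda>t. f (g t))"
      by (rule continuous_on_compose2[OF f g(1)]) auto
    then show "uniform_limit {0..1} (\<lambda>n t. f (X (s n) t) \<bullet> twisted_mode \<theta> i t)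
        (\<lambda>t. f (g t) \<bullet> twisted_mode \<theta> i t) sequentially"
      by (intro bounded_bilinear.bounded_uniform_limit[OF bounded_bilinear_inner] ulf[OF f]
          uniform_limit_const bd continuous_on_twisted_mode)
    show "continuous_on {0..1} (\<lambda>t. f (X (s n) t) \<bullet> twisted_mode \<theta> i t)" for n
      by (intro continuous_intros continuous_on_twisted_mode continuous_on_compose2[OF f cX]) auto
  qed
  show ?thesis
  proof
    show "0 < \<tau>" using \<tau> a by simp
    show "continuous_on {0..1} g" by (rule g(1))
    have l0: "(\<lambda>n. X (s n) 0) \<longlonglongrightarrow> g 0" and l1: "(\<lambda>n. X (s n) 1) \<longlonglongrightarrow> g 1"
      using tendsto_uniform_limitI[OF ul] by auto
    have "(\<lambda>n. twist \<theta> (X (s n) 0)) \<longlonglongrightarrow> twist \<theta> (g 0)"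
      by (intro bounded_linear.tendsto[OF _ l0] linear_twist[unfolded linear_conv_bounded_linear])
    then show "g 1 = twist \<theta> (g 0)" using l1 LIMSEQ_unique by (auto simp: per)
    have "(\<lambda>n. integral {0..1} (\<lambda>t. (norm (X (s n) t))\<^sup>2)) \<longlonglongrightarrow> integral {0..1} (\<lambda>t. (norm (g t))\<^sup>2)"
      by (intro integral_lim ulf[of "\<lambda>z. (norm z)\<^sup>2"] continuous_intros cX continuous_on_id)
    then show "integral {0..1} (\<lambda>t. (norm (g t))\<^sup>2) = 1"
      by (simp add: n1 LIMSEQ_const_iff)
    fix i :: "'n \<times> int \<times> bool"
    obtain j l b where i: "i = (j, l, b)" by (cases i)
    have t1: "(\<lambda>n. twisted_freq \<theta> i * integral {0..1} (\<lambda>t. X (s n) t \<bullet> twisted_mode \<theta> i t)) \<longlonglongrightarrow>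
        twisted_freq \<theta> i * integral {0..1} (\<lambda>t. g t \<bullet> twisted_mode \<theta> i t)"
      using lim_inner[of "\<lambda>z. z" i] by (intro tendsto_intros) (auto intro: continuous_on_id)
    have t2: "(\<lambda>n. T (s n) * integral {0..1} (\<lambda>t. G (X (s n) t) \<bullet> twisted_mode \<theta> i t)) \<longlonglongrightarrow>
        \<tau> * integral {0..1} (\<lambda>t. G (g t) \<bullet> twisted_mode \<theta> i t)"
      by (intro tendsto_intros Ts lim_inner cont_G)
    have ev: "eventually (\<lambda>n. twisted_freq \<theta> i * integral {0..1} (\<lambda>t. X (s n) t \<bullet> twisted_mode \<theta> i t) =
        T (s n) * integral {0..1} (\<lambda>t. G (X (s n) t) \<bullet> twisted_mode \<theta> i t)) sequentially"
      unfolding eventually_sequentially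
    proof (intro exI allI impI)
      \<comment> \<open>Each single mode lies below the cutoff from some index on, so the limit
        satisfies the equation for every mode.\<close>
      fix n assume "nat \<bar>l\<bar> \<le> n"
      then have "i \<in> modes (N0 + s n)" using seq_suble[OF s, of n] by (auto simp: i)
      then show "twisted_freq \<theta> i * integral {0..1} (\<lambda>t. X (s n) t \<bullet> twisted_mode \<theta> i t) =
        T (s n) * integral {0..1} (\<lambda>t. G (X (s n) t) \<bullet> twisted_mode \<theta> i t)"
        using st by (simp add: stationary_coeff_def)
    qed
    show "stationary_coeff g \<tau> i"
      unfolding stationary_coeff_def
      by (rule LIMSEQ_unique[OF Lim_transform_eventually[OF t1 ev] t2])
  qed
qed

end

section \<open>Geometry of the sphere\<close>

lemma cmul_i_cmul_i [simp]: "cmul_i (cmul_i v) = - v"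
  by (simp add: cmul_i_def vec_eq_iff)

lemma inner_cmul_i: "cmul_i u \<bullet> v = - (u \<bullet> cmul_i v)"
  by (simp add: inner_vec_def cmul_i_def inner_complex_def flip: sum_negf)

lemma inner_cmul_i_cmul_i [simp]: "cmul_i u \<bullet> cmul_i v = u \<bullet> v"
  by (simp add: inner_cmul_i)

lemma inner_cmul_i_self [simp]: "v \<bullet> cmul_i v = 0" "cmul_i v \<bullet> v = 0"
  using inner_cmul_i[of v v] by (simp_all add: inner_commute)

lemma liouville_eq: "liouville z v = (cmul_i z \<bullet> v) / 2"
  by (simp add: liouville_def inner_vec_def cmul_i_def inner_complex_def)

lemma cmul_i_linear_simps:
  "cmul_i (u + v) = cmul_i u + cmul_i v" "cmul_i (u - v) = cmul_i u - cmul_i v"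
  "cmul_i (r *\<^sub>R u) = r *\<^sub>R cmul_i u" "cmul_i (- u) = - cmul_i u"
  using linear_add[OF linear_cmul_i] linear_diff[OF linear_cmul_i]
    linear_scale[OF linear_cmul_i] linear_neg[OF linear_cmul_i] by auto

text \<open>Remove the radial part and divide by the distance: this is
  \<open>tangent_proj (sgn z)\<close> up to the factor, the form in which the Reeb field will
  appear.\<close>

lemma has_derivative_sgn:
  fixes z :: "'a::euclidean_space"
  assumes "z \<noteq> 0"
  shows "(sgn has_derivative (\<lambda>h. (1 / norm z) *\<^sub>R (h - (sgn z \<bullet> h) *\<^sub>R sgn z))) (at z)"
proof -
  have "(norm has_derivative (\<lambda>h. sgn z \<bullet> h)) (at z)"
    using has_derivative_norm[OF assms] by (subst inner_commute)
  then have "((\<lambda>z. inverse (norm z) *\<^sub>R z) has_derivative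
      (\<lambda>h. inverse (norm z) *\<^sub>R h + (- (inverse (norm z) * (sgn z \<bullet> h) * inverse (norm z))) *\<^sub>R z)) (at z)"
    using assms by (auto intro!: derivative_eq_intros)
  then show ?thesis
    using assms by (simp add: sgn_div_norm[abs_def] divide_inverse scaleR_diff_right mult_ac)
qed

text \<open>The local extensions of \<open>f\<close> are not canonical, but its radially constant
  extension is. Its local gradients, computed from any of them, agree by uniqueness of derivatives,
  so they join into one continuous field.\<close>

lemma smooth_on_sphere_gradient:
  fixes f :: "'a::euclidean_space \<Rightarrow> real"
  assumes sm: "smooth_on_subset f (sphere 0 1)"
  obtains D where "\<And>z. z \<noteq> 0 \<Longrightarrow> ((\<lambda>z. f (sgn z)) has_derivative (\<lambda>h. D z \<bullet> h)) (at z)"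
    "continuous_on (- {0}) D"
proof -
  have loc: "\<exists>N E. open N \<and> z \<in> N \<and> N \<subseteq> - {0} \<and> continuous_on N E \<and>
      (\<forall>y\<in>N. ((\<lambda>z. f (sgn z)) has_derivative (\<lambda>h. E y \<bullet> h)) (at y))" if z: "z \<noteq> 0" for z
  proof -
    have "sgn z \<in> sphere 0 1" using z by (simp add: norm_sgn)
    then obtain U F where U: "open U" "sgn z \<in> U" "\<forall>k. Ck_on k F U" "\<forall>y\<in>U \<inter> sphere 0 1. F y = f y"
      using sm unfolding smooth_on_subset_def by blast
    have "Ck_on (Suc 0) F U" using U(3) by blast
    then have Fd: "\<And>y. y \<in> U \<Longrightarrow> F differentiable (at y)"
      and Fc: "\<And>v. continuous_on U (\<lambda>y. frechet_derivative F (at y) v)" by auto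
    define N where "N = - {0} \<inter> sgn -` U"
    have csgn: "continuous_on (- {0}) (sgn :: 'a \<Rightarrow> 'a)"
      by (intro continuous_on_sgn continuous_on_id) auto
    have N: "open N" unfolding N_def
      using continuous_open_preimage[OF csgn _ U(1)] by (simp add: open_Compl)
    define gF where "gF y = (\<Sum>b\<in>Basis. frechet_derivative F (at y) b *\<^sub>R b)" for y
    have gF: "(F has_derivative (\<lambda>h. gF y \<bullet> h)) (at y)" if "y \<in> U" for y
    proof -
      have d: "(F has_derivative frechet_derivative F (at y)) (at y)"
        using Fd[OF that] frechet_derivative_works by blast
      have "frechet_derivative F (at y) h = gF y \<bullet> h" for h
      proof -
        have l: "linear (frechet_derivative F (at y))" using d by (rule has_derivative_linear)
        have "frechet_derivative F (at y) h = frechet_derivative F (at y) (\<Sum>b\<in>Basis. (h \<bullet> b) *\<^sub>R b)"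
          by (simp add: euclidean_representation)
        also have "\<dots> = gF y \<bullet> h"
          by (simp add: linear_sum[OF l] linear_scale[OF l] gF_def inner_sum_left)
             (simp add: inner_commute mult.commute)
        finally show ?thesis .
      qed
      then have "frechet_derivative F (at y) = (\<lambda>h. gF y \<bullet> h)" by blast
      with d show ?thesis by simp
    qed
    have cgF: "continuous_on U gF"
      unfolding gF_def[abs_def] by (intro continuous_intros Fc)
    define E where "E y = (1 / norm y) *\<^sub>R (gF (sgn y) - (gF (sgn y) \<bullet> sgn y) *\<^sub>R sgn y)" for y
    have csN: "continuous_on N (sgn :: 'a \<Rightarrow> 'a)"
      using csgn by (rule continuous_on_subset) (auto simp: N_def)
    have cg: "continuous_on N (\<lambda>y. gF (sgn y))"
      by (rule continuous_on_compose2[OF cgF csN]) (auto simp: N_def)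
    have "continuous_on N E"
      unfolding E_def[abs_def] by (intro continuous_intros cg csN) (auto simp: N_def)
    moreover have "((\<lambda>z. f (sgn z)) has_derivative (\<lambda>h. E y \<bullet> h)) (at y)" if y: "y \<in> N" for y
    proof (rule has_derivative_transform_within_open[OF _ N y])
      have y0: "y \<noteq> 0" "sgn y \<in> U" using y by (auto simp: N_def)
      have "((\<lambda>z. F (sgn z)) has_derivative (\<lambda>h. gF (sgn y) \<bullet> ((1 / norm y) *\<^sub>R (h - (sgn y \<bullet> h) *\<^sub>R sgn y)))) (at y)"
        by (rule has_derivative_compose[OF has_derivative_sgn[OF y0(1)] gF[OF y0(2)]])
      then show "((\<lambda>z. F (sgn z)) has_derivative (\<lambda>h. E y \<bullet> h)) (at y)"
        by (simp add: E_def inner_diff_left inner_diff_right algebra_simps)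
      show "F (sgn x) = f (sgn x)" if "x \<in> N" for x
        using that U(4) by (auto simp: N_def norm_sgn)
    qed
    ultimately show ?thesis
      using N z U(2) by (intro exI[of _ N] exI[of _ E]) (auto simp: N_def)
  qed
  define D where "D z = (SOME g. ((\<lambda>z. f (sgn z)) has_derivative (\<lambda>h. g \<bullet> h)) (at z))" for z
  have D: "((\<lambda>z. f (sgn z)) has_derivative (\<lambda>h. D z \<bullet> h)) (at z)" if z: "z \<noteq> 0" for z
  proof -
    obtain N E where "z \<in> N" "\<forall>y\<in>N. ((\<lambda>z. f (sgn z)) has_derivative (\<lambda>h. E y \<bullet> h)) (at y)"
      using loc[OF z] by blast
    then have "\<exists>g. ((\<lambda>z. f (sgn z)) has_derivative (\<lambda>h. g \<bullet> h)) (at z)"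
      by (intro exI[of _ "E z"]) (rule bspec)
    then show ?thesis unfolding D_def by (rule someI_ex)
  qed
  have "isCont D z" if z: "z \<noteq> 0" for z
  proof -
    obtain N E where N: "open N" "z \<in> N" "N \<subseteq> - {0}" "continuous_on N E"
      "\<forall>y\<in>N. ((\<lambda>z. f (sgn z)) has_derivative (\<lambda>h. E y \<bullet> h)) (at y)"
      using loc[OF z] by blast
    have "E y = D y" if "y \<in> N" for y
    proof -
      have "y \<noteq> 0" using that N(3) by auto
      then have "(\<lambda>h. E y \<bullet> h) = (\<lambda>h. D y \<bullet> h)"
        using has_derivative_unique[OF bspec[OF N(5) that] D] by simp
      then show ?thesis by (metis vector_eq_rdot)
    qed
    then have "continuous_on N D" using N(4) by (simp cong: continuous_on_cong)
    then show ?thesis using N(1,2) continuous_on_eq_continuous_at by blast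
  qed
  then have "continuous_on (- {0}) D" by (auto intro!: continuous_at_imp_continuous_on)
  then show ?thesis using that D by blast
qed

text \<open>A derivative within the sphere is not determined in the normal direction, so
  \<open>frechet_derivative\<close> makes an unknown choice there. In a tangent direction the chain
  rule along a great circle pins it down.\<close>

lemma sphere_tangent_derivative_unique:
  fixes x :: "'a::euclidean_space"
  assumes D1: "(g has_derivative D1) (at x within sphere 0 1)"
    and D2: "(g has_derivative D2) (at x within sphere 0 1)"
    and x: "norm x = 1" and u: "x \<bullet> u = 0"
  shows "D1 u = D2 u"
proof (cases "u = 0")
  case True
  then show ?thesis
    using linear_0[OF has_derivative_linear[OF D1]] linear_0[OF has_derivative_linear[OF D2]] by simp
next
  case False
  define c where "c t = cos (norm u * t) *\<^sub>R x + (sin (norm u * t) / norm u) *\<^sub>R u" for t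
  have c0: "c 0 = x" by (simp add: c_def)
  have c1: "c t \<in> sphere 0 1" for t
  proof -
    have "(norm (c t))\<^sup>2 = (cos (norm u * t))\<^sup>2 + (sin (norm u * t))\<^sup>2"
      using x u False unfolding c_def
      by (subst norm_add_Pythagorean) (auto simp: orthogonal_def)
    then show ?thesis by (simp add: power2_eq_1_iff) (metis abs_norm_cancel abs_1 abs_minus_cancel)
  qed
  have dc: "(c has_derivative (\<lambda>h. h *\<^sub>R u)) (at 0)"
    unfolding c_def[abs_def] using False by (auto intro!: derivative_eq_intros)
  have comp: "((\<lambda>t. g (c t)) has_derivative (\<lambda>h. D (h *\<^sub>R u))) (at 0)"
    if "(g has_derivative D) (at x within sphere 0 1)" for D
  proof (rule has_derivative_in_compose[OF dc])
    show "(g has_derivative D) (at (c 0) within range c)"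
      unfolding c0 using c1 by (intro has_derivative_subset[OF that]) auto
  qed
  have "(\<lambda>h. D1 (h *\<^sub>R u)) = (\<lambda>h. D2 (h *\<^sub>R u))"
    by (rule has_derivative_unique[OF comp[OF D1] comp[OF D2]])
  from fun_cong[OF this, of 1] show ?thesis by simp
qed

section \<open>Twisted orbits\<close>

lemma vec_sum_axis: "(\<Sum>j\<in>UNIV. axis j (v $ j)) = (v :: 'a::comm_monoid_add ^ 'n::finite)"
  by (simp add: vec_eq_iff axis_def)

lemma has_vector_derivative_vec_componentwise:
  fixes x :: "real \<Rightarrow> 'a::real_normed_vector ^ 'n::finite"
  assumes "\<And>j. ((\<lambda>t. x t $ j) has_vector_derivative v $ j) F"
  shows "(x has_vector_derivative v) F"
proof -
  have "((\<lambda>t. \<Sum>j\<in>UNIV. axis j (x t $ j)) has_vector_derivative (\<Sum>j\<in>UNIV. axis j (v $ j))) F"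
    by (intro has_vector_derivative_sum has_vector_derivative_axis assms)
  then show ?thesis by (simp add: vec_sum_axis)
qed

context twisted_hamiltonian begin

text \<open>Multiplying coordinate \<open>j\<close> by \<rho> removes the twist, and the modes
  become ordinary characters; \<open>fourier_antiderivative\<close> then turns the weak equation
  into a classical one.\<close>

lemma orbit_of_stationary_coeff:
  assumes c: "continuous_on {0..1} x" and per: "x 1 = twist \<theta> (x 0)"
    and st: "\<And>i. stationary_coeff x \<tau> i" and t: "t \<in> {0..1}"
  shows "(x has_vector_derivative \<tau> *\<^sub>R cmul_i (G (x t))) (at t within {0..1})"
proof (rule has_vector_derivative_vec_componentwise)
  fix j
  have cG: "continuous_on {0..1} (\<lambda>t. G (x t))"
    by (rule continuous_on_compose2[OF cont_G c]) auto
  define \<rho> where "\<rho> t = cis (- (2 * pi * \<theta> j) * t)" for t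
  have c\<rho>: "continuous_on A \<rho>" for A
    unfolding \<rho>_def[abs_def] by (intro continuous_intros)
  define X where "X t = \<rho> t * x t $ j" for t
  \<comment> \<open>The derivative of \<open>X\<close> that the product rule predicts if the
    equation holds.\<close>
  define \<Gamma> where "\<Gamma> t = \<rho> t * (\<i> * (of_real \<tau> * G (x t) $ j - of_real (2 * pi * \<theta> j) * x t $ j))" for t
  have "(X has_vector_derivative \<Gamma> t) (at t within {0..1})"
  proof (rule fourier_antiderivative[OF _ _ _ _ t])
    show "continuous_on {0..1} X" unfolding X_def[abs_def] by (intro continuous_intros c\<rho> c)
    show "continuous_on {0..1} \<Gamma>" unfolding \<Gamma>_def[abs_def] by (intro continuous_intros c\<rho> c cG)
    show "X 0 = X 1"
      by (simp add: X_def \<rho>_def per twist_def cis_mult flip: mult.assoc)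
    fix k :: int
    \<comment> \<open>Frequency \<open>- k\<close>, because the coefficients of \<open>X\<close> are
      taken against \<open>fourier_char k\<close> without conjugation.\<close>
    define \<omega> where "\<omega> = 2 * pi * (of_int (- k) + \<theta> j)"
    have coeff: "integral {0..1} (\<lambda>t. f t $ j * (\<rho> t * fourier_char k t)) =
        of_real (integral {0..1} (\<lambda>t. f t \<bullet> twisted_mode \<theta> (j, - k, True) t)) +
        \<i> * of_real (integral {0..1} (\<lambda>t. f t \<bullet> twisted_mode \<theta> (j, - k, False) t))"
      if f: "continuous_on {0..1} f" for f
    proof -
      have "\<rho> t * fourier_char k t = cis (- (2 * pi * (of_int (- k) + \<theta> j) * t))" for t
        by (simp add: \<rho>_def fourier_char_def cis_mult algebra_simps)
      then have eq: "f t $ j * (\<rho> t * fourier_char k t) =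
          of_real (f t \<bullet> twisted_mode \<theta> (j, - k, True) t) + \<i> * of_real (f t \<bullet> twisted_mode \<theta> (j, - k, False) t)" for t
        by (simp only: twisted_mode_coeff)
      have hi: "((\<lambda>t. complex_of_real (f t \<bullet> twisted_mode \<theta> i t)) has_integral
          of_real (integral {0..1} (\<lambda>t. f t \<bullet> twisted_mode \<theta> i t))) {0..1}" for i
        by (intro has_integral_of_real integrable_integral integrable_continuous_real
            continuous_intros f continuous_on_twisted_mode)
      show ?thesis
        unfolding eq by (intro integral_unique has_integral_add has_integral_mult_right hi)
    qed
    have *: "of_real \<omega> * integral {0..1} (\<lambda>t. x t $ j * (\<rho> t * fourier_char k t)) =
        of_real \<tau> * integral {0..1} (\<lambda>t. G (x t) $ j * (\<rho> t * fourier_char k t))"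
    proof -
      have "\<omega> * integral {0..1} (\<lambda>t. x t \<bullet> twisted_mode \<theta> (j, - k, b) t) =
          \<tau> * integral {0..1} (\<lambda>t. G (x t) \<bullet> twisted_mode \<theta> (j, - k, b) t)" for b
        using st[of "(j, - k, b)"] by (simp add: stationary_coeff_def twisted_freq_def \<omega>_def)
      from this[of True] this[of False] show ?thesis
        unfolding coeff[OF c] coeff[OF cG]
        by (simp add: distrib_left complex_eq_iff)
    qed
    have "integral {0..1} (\<lambda>t. \<Gamma> t * fourier_char k t) =
        integral {0..1} (\<lambda>t. \<i> * of_real \<tau> * (G (x t) $ j * (\<rho> t * fourier_char k t))
          - \<i> * of_real (2 * pi * \<theta> j) * (x t $ j * (\<rho> t * fourier_char k t)))"
      by (simp add: \<Gamma>_def algebra_simps)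
    also have "\<dots> = \<i> * of_real \<tau> * integral {0..1} (\<lambda>t. G (x t) $ j * (\<rho> t * fourier_char k t))
        - \<i> * of_real (2 * pi * \<theta> j) * integral {0..1} (\<lambda>t. x t $ j * (\<rho> t * fourier_char k t))"
      by (subst integral_diff)
         (intro integrable_continuous_real continuous_intros c c\<rho> cG, intro integrable_continuous_real continuous_intros c c\<rho> cG, simp)
    also have "\<dots> = \<i> * of_real (\<omega> - 2 * pi * \<theta> j) * integral {0..1} (\<lambda>t. x t $ j * (\<rho> t * fourier_char k t))"
      by (simp add: mult.assoc flip: *) (simp add: algebra_simps)
    also have "\<omega> - 2 * pi * \<theta> j = - (2 * pi * of_int k)"
      by (simp add: \<omega>_def algebra_simps)
    finally show "- (2 * pi * \<i> * of_int k) * integral {0..1} (\<lambda>t. X t * fourier_char k t) =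
        integral {0..1} (\<lambda>t. \<Gamma> t * fourier_char k t)"
      by (simp add: X_def mult_ac)
  qed
  then have "((\<lambda>t. cis ((2 * pi * \<theta> j) * t) * X t) has_vector_derivative
      (cis ((2 * pi * \<theta> j) * t) * \<Gamma> t + \<i> * of_real (2 * pi * \<theta> j) * cis ((2 * pi * \<theta> j) * t) * X t))
      (at t within {0..1})"
    by (intro has_vector_derivative_mult has_vector_derivative_cis)
  moreover have inv: "cis ((2 * pi * \<theta> j) * t) * (\<rho> t * z) = z" for t z
    by (simp add: \<rho>_def cis_mult flip: mult.assoc)
  moreover have "cis ((2 * pi * \<theta> j) * t) * \<Gamma> t + \<i> * of_real (2 * pi * \<theta> j) * cis ((2 * pi * \<theta> j) * t) * X t
      = (\<tau> *\<^sub>R cmul_i (G (x t))) $ j"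
    unfolding \<Gamma>_def X_def mult.assoc[of _ "cis _"] inv
    by (simp add: cmul_i_def scaleR_conv_of_real[where 'a = complex] algebra_simps)
  ultimately show "((\<lambda>t. x t $ j) has_vector_derivative (\<tau> *\<^sub>R cmul_i (G (x t))) $ j) (at t within {0..1})"
    by (simp add: X_def)
qed

lemma H_constant_along_orbit:
  assumes d: "\<And>t. t \<in> {0..1} \<Longrightarrow> (x has_vector_derivative \<tau> *\<^sub>R cmul_i (G (x t))) (at t within {0..1})"
    and t: "t \<in> {0..1}" "s \<in> {0..1}"
  shows "H (x t) = H (x s)"
proof -
  have "((\<lambda>t. H (x t)) has_derivative (\<lambda>h. 0)) (at t within {0..1})" if "t \<in> {0..1}" for t
  proof -
    have "((\<lambda>t. H (x t)) has_derivative (\<lambda>h. G (x t) \<bullet> (h *\<^sub>R \<tau> *\<^sub>R cmul_i (G (x t))))) (at t within {0..1})"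
      by (rule has_derivative_compose[OF d[OF that, unfolded has_vector_derivative_def] deriv])
    then show ?thesis by simp
  qed
  then obtain c where "\<And>t. t \<in> {0..1} \<Longrightarrow> H (x t) = c"
    using has_derivative_zero_constant[of "{0..1}" "\<lambda>t. H (x t)"] by (auto simp: convex_real_interval)
  then show ?thesis using t by simp
qed

text \<open>\<open>H\<close> is conserved and positive off the origin, so a path with one zero would
  vanish identically, against its unit norm.\<close>

lemma orbit_segment_exists:
  obtains x \<tau> where "0 < \<tau>" "x 1 = twist \<theta> (x 0)" "\<And>t. t \<in> {0..1} \<Longrightarrow> x t \<noteq> 0"
    "\<And>t. t \<in> {0..1} \<Longrightarrow> (x has_vector_derivative \<tau> *\<^sub>R cmul_i (G (x t))) (at t within {0..1})"
proof -
  obtain x \<tau> where x: "0 < \<tau>" "continuous_on {0..1} x" "x 1 = twist \<theta> (x 0)"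
    "integral {0..1} (\<lambda>t. (norm (x t))\<^sup>2) = 1" "\<And>i. stationary_coeff x \<tau> i"
    by (rule weak_orbit_exists) blast
  have d: "(x has_vector_derivative \<tau> *\<^sub>R cmul_i (G (x t))) (at t within {0..1})" if "t \<in> {0..1}" for t
    by (rule orbit_of_stationary_coeff[OF x(2,3,5) that])
  have "x t \<noteq> 0" if t: "t \<in> {0..1}" for t
  proof
    assume "x t = 0"
    then have "H (x s) = 0" if "s \<in> {0..1}" for s
      using H_constant_along_orbit[OF d that t] by simp
    then have z: "x s = 0" if "s \<in> {0..1}" for s
      using that pos by force
    have "integral {0..1} (\<lambda>t. (norm (x t))\<^sup>2) = integral {0..1} (\<lambda>t::real. 0 :: real)"
      by (intro integral_cong) (simp add: z)
    then show False using x(4) by simp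
  qed
  then show ?thesis using that x(1,3) d by blast
qed

end

section \<open>Extension of an orbit segment to the whole line\<close>

lemma has_vector_derivative_within_Un:
  assumes "(f has_vector_derivative d) (at x within A)" "(f has_vector_derivative d) (at x within B)"
  shows "(f has_vector_derivative d) (at x within (A \<union> B))"
  using assms unfolding has_vector_derivative_def has_derivative_at_within
  by (auto simp: at_within_union intro: filterlim_sup)

text \<open>\<open>R m\<close> is the \<open>m\<close>-th power of the symmetry.\<close>

lemma equivariant_continuation:
  fixes x :: "real \<Rightarrow> 'a::euclidean_space" and R :: "int \<Rightarrow> 'a \<Rightarrow> 'a"
  assumes lin: "\<And>m. linear (R m)" and add: "\<And>m v. R (m + 1) v = R m (R 1 v)"
    and equiv: "\<And>m v. F (R m v) = R m (F v)" and R0: "\<And>v. R 0 v = v"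
    and close: "x 1 = R 1 (x 0)"
    and d: "\<And>t. t \<in> {0..1} \<Longrightarrow> (x has_vector_derivative F (x t)) (at t within {0..1})"
  defines "X \<equiv> \<lambda>t. R \<lfloor>t\<rfloor> (x (frac t))"
  shows "(X has_vector_derivative F (X t)) (at t)"
proof -
  \<comment> \<open>Valid also at the right end point, thanks to \<open>close\<close>; this
    closed-interval form is what yields both one-sided derivatives at integers.\<close>
  have X: "X t = R m (x (t - of_int m))" if "t \<in> {of_int m..of_int m + 1}" for t m
  proof (cases "t = of_int m + 1")
    case True
    then have "\<lfloor>t\<rfloor> = m + 1" "frac t = 0" by (auto simp: frac_def)
    then show ?thesis using True by (simp add: X_def add close)
  next
    case False
    then have "\<lfloor>t\<rfloor> = m" using that by (intro floor_unique) auto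
    then show ?thesis by (simp add: X_def frac_def)
  qed
  have dX: "(X has_vector_derivative F (X t)) (at t within {of_int m..of_int m + 1})"
    if t: "t \<in> {of_int m..of_int m + 1}" for t m
  proof -
    have im: "(\<lambda>s. s - of_int m) ` {of_int m..of_int m + 1} \<subseteq> {0..1::real}" by auto
    have "((\<lambda>s. s - of_int m) has_vector_derivative 1) (at t within {of_int m..of_int m + 1})"
      by (auto intro!: derivative_eq_intros)
    moreover have "(x has_vector_derivative F (x (t - of_int m)))
        (at (t - of_int m) within (\<lambda>s. s - of_int m) ` {of_int m..of_int m + 1})"
      using t by (intro has_vector_derivative_within_subset[OF d im]) auto
    ultimately have "((\<lambda>s. x (s - of_int m)) has_vector_derivative F (x (t - of_int m)))
        (at t within {of_int m..of_int m + 1})"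
      using vector_diff_chain_within[of "\<lambda>s. s - of_int m" 1 t _ x] by (simp add: o_def)
    then have "((\<lambda>s. R m (x (s - of_int m))) has_vector_derivative R m (F (x (t - of_int m))))
        (at t within {of_int m..of_int m + 1})"
      by (rule bounded_linear.has_vector_derivative[OF lin[unfolded linear_conv_bounded_linear]])
    then have "(X has_vector_derivative R m (F (x (t - of_int m)))) (at t within {of_int m..of_int m + 1})"
      by (rule has_vector_derivative_transform[OF t X, rotated])
    then show ?thesis using X[OF t] equiv by simp
  qed
  define m where "m = \<lfloor>t\<rfloor>"
  have m: "of_int m \<le> t" "t < of_int m + 1" unfolding m_def by linarith+
  show ?thesis
  proof (cases "t = of_int m")
    case False
    then have "at t within {of_int m..of_int m + 1} = at t"
      using m by (intro at_within_Icc_at) auto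
    moreover have "(X has_vector_derivative F (X t)) (at t within {of_int m..of_int m + 1})"
      using m by (intro dX) auto
    ultimately show ?thesis by metis
  next
    \<comment> \<open>At an integer the pieces on both sides have the same derivative
      \<open>F (X t)\<close>, by equivariance of \<open>F\<close>.\<close>
    case True
    then have eq: "of_int (m - 1) = t - 1" "of_int m = t" by auto
    have "(X has_vector_derivative F (X t)) (at t within {t - 1..t})"
      using dX[of t "m - 1"] unfolding eq by simp
    moreover have "(X has_vector_derivative F (X t)) (at t within {t..t + 1})"
      using dX[of t m] unfolding eq by simp
    ultimately have "(X has_vector_derivative F (X t)) (at t within {t - 1..t} \<union> {t..t + 1})"
      by (rule has_vector_derivative_within_Un)
    moreover have "{t - 1..t} \<union> {t..t + 1} = {t - 1..t + 1}" by auto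
    moreover have "at t within {t - 1..t + 1} = at t" by (rule at_within_Icc_at) auto
    ultimately show ?thesis by metis
  qed
qed

section \<open>The Reeb field as a projected Hamiltonian field\<close>

lemma tangent_proj_linear_simps:
  "tangent_proj y (u + v) = tangent_proj y u + tangent_proj y v"
  "tangent_proj y (r *\<^sub>R u) = r *\<^sub>R tangent_proj y u"
  by (simp_all add: tangent_proj_def inner_add_right scaleR_diff_right scaleR_add_left)

locale contact_sphere =
  fixes \<alpha> :: "complex ^ 'n::finite \<Rightarrow> complex ^ 'n \<Rightarrow> real" and f D
  assumes f_pos: "x \<in> unit_sphere \<Longrightarrow> 0 < f x"
    and form: "x \<in> unit_sphere \<Longrightarrow> v \<in> sphere_tangent x \<Longrightarrow> \<alpha> x v = f x * liouville x v"
    and D: "z \<noteq> 0 \<Longrightarrow> ((\<lambda>z. f (sgn z)) has_derivative (\<lambda>h. D z \<bullet> h)) (at z)"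
    and cont_D: "continuous_on (- {0}) D"
begin

text \<open>The level set \<open>ham = 1\<close> is the starshaped hypersurface on which the Liouville form restricts
  to \<open>\<alpha>\<close> under radial projection.\<close>

definition ham where "ham z = (norm z)\<^sup>2 / f (sgn z)"

text \<open>The quotient rule for \<open>ham\<close>. At the origin both terms vanish whatever the
  values of \<open>f\<close> and \<open>D\<close> there.\<close>

definition ham_grad where
  "ham_grad z = (2 / f (sgn z)) *\<^sub>R z - ((norm z / f (sgn z))\<^sup>2) *\<^sub>R D z"

lemma sgn_in_sphere: "z \<noteq> 0 \<Longrightarrow> sgn z \<in> unit_sphere"
  by (simp add: norm_sgn)

lemma f_sgn_pos: "z \<noteq> 0 \<Longrightarrow> 0 < f (sgn z)"
  by (rule f_pos[OF sgn_in_sphere])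

lemma cont_f_sgn: "continuous_on (- {0}) (\<lambda>z. f (sgn z))"
  by (rule has_derivative_continuous_on[OF has_derivative_at_withinI[OF D]]) simp

lemma D_scale:
  assumes "0 < r" "z \<noteq> 0"
  shows "D (r *\<^sub>R z) = (1 / r) *\<^sub>R D z"
proof -
  have "((\<lambda>z. f (sgn (r *\<^sub>R z))) has_derivative (\<lambda>h. D (r *\<^sub>R z) \<bullet> (r *\<^sub>R h))) (at z)"
    by (rule has_derivative_compose[OF _ D]) (use assms in \<open>auto intro!: derivative_eq_intros\<close>)
  moreover have "((\<lambda>z. f (sgn (r *\<^sub>R z))) has_derivative (\<lambda>h. D z \<bullet> h)) (at z)"
    using D[OF assms(2)] assms(1) by (simp add: sgn_scaleR)
  ultimately have eq: "(\<lambda>h. D (r *\<^sub>R z) \<bullet> (r *\<^sub>R h)) = (\<lambda>h. D z \<bullet> h)"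
    by (rule has_derivative_unique)
  have "D (r *\<^sub>R z) \<bullet> h = ((1 / r) *\<^sub>R D z) \<bullet> h" for h
    using fun_cong[OF eq, of h] assms by (simp add: field_simps)
  then show ?thesis by (metis vector_eq_rdot)
qed

text \<open>\<open>f (sgn z)\<close> is constant along rays.\<close>

lemma D_orthogonal:
  assumes "z \<noteq> 0"
  shows "D z \<bullet> z = 0"
proof -
  have "((\<lambda>r. f (sgn (r *\<^sub>R z))) has_derivative (\<lambda>h. D (1 *\<^sub>R z) \<bullet> (h *\<^sub>R z))) (at 1)"
    by (rule has_derivative_compose[OF _ D]) (use assms in \<open>auto intro!: derivative_eq_intros\<close>)
  moreover have "((\<lambda>r. f (sgn (r *\<^sub>R z))) has_derivative (\<lambda>h. 0)) (at 1)"
    by (rule has_derivative_transform_within_open[where s = "{0<..}" and f = "\<lambda>r. f (sgn z)"])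
       (auto simp: sgn_scaleR)
  ultimately have "(\<lambda>h. D (1 *\<^sub>R z) \<bullet> (h *\<^sub>R z)) = (\<lambda>h. 0)"
    by (rule has_derivative_unique)
  from fun_cong[OF this, of 1] show ?thesis by simp
qed

lemma ham_grad_scale:
  assumes "0 < r"
  shows "ham_grad (r *\<^sub>R z) = r *\<^sub>R ham_grad z"
proof (cases "z = 0")
  case False
  then show ?thesis
    using assms by (simp add: ham_grad_def sgn_scaleR D_scale scaleR_diff_right power2_eq_square mult_ac)
qed (simp add: ham_grad_def)

lemma ham_bound:
  obtains m where "0 < m" "\<And>z. ham z \<le> (norm z)\<^sup>2 / m"
proof -
  have "sphere (0 :: complex ^ 'n) 1 \<noteq> {}" by simp
  moreover have "continuous_on (unit_sphere :: (complex ^ 'n) set) (\<lambda>z. f (sgn z))"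
    by (rule continuous_on_subset[OF cont_f_sgn]) auto
  ultimately obtain y where y: "y \<in> unit_sphere" "\<And>z. z \<in> unit_sphere \<Longrightarrow> f (sgn y) \<le> f (sgn z)"
    using continuous_attains_inf[OF compact_sphere] by blast
  have y0: "y \<noteq> 0" using y(1) by auto
  have "ham z \<le> (norm z)\<^sup>2 / f (sgn y)" for z
  proof (cases "z = 0")
    case False
    have "f (sgn y) \<le> f (sgn z)"
      using y(2)[OF sgn_in_sphere[OF False]] False by (simp add: sgn_div_norm)
    then show ?thesis
      unfolding ham_def using f_sgn_pos[OF y0] by (intro divide_left_mono) auto
  qed (simp add: ham_def)
  then show ?thesis using that f_sgn_pos[OF y0] by blast
qed

lemma ham_nonneg: "0 \<le> ham z"
  using f_sgn_pos[of z] by (cases "z = 0") (auto simp: ham_def)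

text \<open>Away from the origin this is calculus. At the origin homogeneity replaces it:
  \<open>ham\<close> is bounded by a multiple of the squared norm, which gives derivative 0, and
  \<open>ham_grad\<close> by a multiple of the norm, which gives continuity.\<close>

sublocale quadratic_hamiltonian ham ham_grad
proof
  show "(ham has_derivative (\<lambda>h. ham_grad z \<bullet> h)) (at z)" for z
  proof (cases "z = 0")
    case True
    obtain m where m: "0 < m" "\<And>z. ham z \<le> (norm z)\<^sup>2 / m" by (rule ham_bound) blast
    have "(ham has_derivative (\<lambda>h. 0)) (at 0)"
    proof (rule has_derivativeI_sandwich[of 1 _ _ _ _ "\<lambda>z. norm z / m"])
      show "norm (ham y - ham 0 - 0) / norm (y - 0) \<le> norm y / m" if "y \<noteq> 0" for y
        using m(2)[of y] that ham_nonneg[of y] m(1)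
        by (simp add: ham_def[of 0] divide_le_eq power2_eq_square)
      show "((\<lambda>z. norm (z :: complex ^ 'n) / m) \<longlongrightarrow> 0) (at 0)"
        by (intro tendsto_divide_zero tendsto_norm_zero tendsto_ident_at)
    qed auto
    then show ?thesis using True by (simp add: ham_grad_def)
  next
    case False
    have "((\<lambda>z. (z \<bullet> z) / f (sgn z)) has_derivative
        (\<lambda>h. - (z \<bullet> z) * (inverse (f (sgn z)) * (D z \<bullet> h) * inverse (f (sgn z))) + (z \<bullet> h + h \<bullet> z) / f (sgn z))) (at z)"
      using f_sgn_pos[OF False] by (intro has_derivative_divide has_derivative_inner has_derivative_ident D False) auto
    moreover have "- (z \<bullet> z) * (inverse (f (sgn z)) * (D z \<bullet> h) * inverse (f (sgn z))) + (z \<bullet> h + h \<bullet> z) / f (sgn z)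
        = ham_grad z \<bullet> h" for h
      by (simp add: ham_grad_def inner_diff_left inner_commute[of h z] divide_inverse
          power_mult_distrib power2_norm_eq_inner power2_eq_square[of "inverse (f (sgn z))"])
    ultimately show ?thesis
      by (simp add: ham_def[abs_def] power2_norm_eq_inner)
  qed
  show "continuous_on UNIV ham_grad"
  proof -
    have c: "continuous_on (- {0}) ham_grad"
      unfolding ham_grad_def[abs_def]
      using f_sgn_pos by (intro continuous_intros cont_f_sgn cont_D) (auto simp: less_imp_neq[symmetric])
    have "compact (ham_grad ` unit_sphere)"
      by (intro compact_continuous_image continuous_on_subset[OF c]) auto
    then obtain C where C: "\<And>z. z \<in> unit_sphere \<Longrightarrow> norm (ham_grad z) \<le> C"
      by (meson bounded_iff compact_imp_bounded image_eqI)
    have bnd: "norm (ham_grad z) \<le> C * norm z" for z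
    proof (cases "z = 0")
      case False
      then have "ham_grad z = norm z *\<^sub>R ham_grad (sgn z)"
        using ham_grad_scale[of "norm z" "sgn z"] by (simp add: sgn_div_norm)
      then show ?thesis
        using mult_left_mono[OF C[OF sgn_in_sphere[OF False]] norm_ge_zero[of z]]
        by (simp add: mult.commute)
    qed (simp add: ham_grad_def)
    have "((\<lambda>z :: complex ^ 'n. C * norm z) \<longlongrightarrow> C * norm (0 :: complex ^ 'n)) (at 0)"
      by (intro tendsto_intros)
    then have "(ham_grad \<longlongrightarrow> 0) (at 0)"
      using bnd by (intro Lim_null_comparison[of ham_grad "\<lambda>z. C * norm z"]) auto
    then have "isCont ham_grad 0" by (simp add: isCont_def ham_grad_def)
    moreover have "isCont ham_grad z" if "z \<noteq> 0" for z
      using c that by (simp add: continuous_on_eq_continuous_at open_Compl)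
    ultimately show ?thesis by (metis continuous_at_imp_continuous_on)
  qed
  show "ham (r *\<^sub>R z) = r\<^sup>2 * ham z" if "0 \<le> r" for r z
    using that by (cases "r = 0") (auto simp: ham_def sgn_scaleR power_mult_distrib)
  show "0 < ham z" if "z \<noteq> 0" for z
    using that f_sgn_pos[OF that] by (simp add: ham_def)
qed

text \<open>This is d(f \<lambda>) = df \<and> \<lambda> + f d\<lambda>, where \<lambda> at x is
  half the inner product with i x and d\<lambda>(u, v) is the inner product of i u with v.\<close>

lemma sphere_ext_deriv_eq:
  assumes x: "x \<in> unit_sphere" and u: "x \<bullet> u = 0" and v: "x \<bullet> v = 0"
  shows "sphere_ext_deriv \<alpha> x u v =
    (D x \<bullet> u) * (cmul_i x \<bullet> v) / 2 - (D x \<bullet> v) * (cmul_i x \<bullet> u) / 2 + f x * (cmul_i u \<bullet> v)"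
proof -
  have x0: "x \<noteq> 0" and sx: "sgn x = x" and nx: "norm x = 1"
    using x by (auto simp: sgn_div_norm)
  have d: "frechet_derivative (\<lambda>y. \<alpha> y (tangent_proj y b)) (at x within unit_sphere) a =
      (D x \<bullet> a) * (cmul_i x \<bullet> b) / 2 + f x * (cmul_i a \<bullet> b) / 2" if a: "x \<bullet> a = 0" for a b
  proof -
    let ?g = "\<lambda>y. f (sgn y) * (cmul_i y \<bullet> b) / 2"
    let ?d = "\<lambda>h. (f (sgn x) * (cmul_i h \<bullet> b) + (D x \<bullet> h) * (cmul_i x \<bullet> b)) / 2"
    have lin: "(cmul_i has_derivative cmul_i) (at x)"
      using linear_cmul_i by (intro bounded_linear_imp_has_derivative) (simp add: linear_conv_bounded_linear)
    have "((\<lambda>y. cmul_i y \<bullet> b) has_derivative (\<lambda>h. cmul_i h \<bullet> b)) (at x)"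
      by (rule has_derivative_inner_left[OF lin])
    from has_derivative_mult[OF D[OF x0] this] have "(?g has_derivative ?d) (at x)"
      by (rule bounded_linear.has_derivative[OF bounded_linear_divide])
    then have g: "(?g has_derivative ?d) (at x within unit_sphere)"
      by (rule has_derivative_at_withinI)
    \<comment> \<open>The projection disappears because i y is orthogonal to y.\<close>
    have eq: "\<alpha> y (tangent_proj y b) = ?g y" if y: "y \<in> unit_sphere" for y
    proof -
      have ny: "y \<bullet> y = 1" "sgn y = y" using y by (auto simp: dot_square_norm sgn_div_norm)
      have "tangent_proj y b \<in> sphere_tangent y"
        by (simp add: sphere_tangent_def tangent_proj_def inner_diff_right ny)
      then have "\<alpha> y (tangent_proj y b) = f y * liouville y (tangent_proj y b)"
        using form y by blast
      also have "\<dots> = ?g y"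
        by (simp add: liouville_eq tangent_proj_def inner_diff_right ny)
      finally show ?thesis .
    qed
    have h: "((\<lambda>y. \<alpha> y (tangent_proj y b)) has_derivative ?d) (at x within unit_sphere)"
      by (rule has_derivative_transform[OF x eq g])
    then have "((\<lambda>y. \<alpha> y (tangent_proj y b)) has_derivative
        frechet_derivative (\<lambda>y. \<alpha> y (tangent_proj y b)) (at x within unit_sphere)) (at x within unit_sphere)"
      by (auto simp: differentiable_def simp flip: frechet_derivative_works)
    from sphere_tangent_derivative_unique[OF this h nx a] show ?thesis
      by (simp add: sx add_divide_distrib)
  qed
  show ?thesis
    unfolding sphere_ext_deriv_def d[OF u] d[OF v]
    using inner_cmul_i[of v u] by (simp add: inner_commute)
qed

text \<open>The candidate satisfies the Reeb equations by direct computation with the real number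
  \<open>k = 1 / f y\<close>. The description by \<open>THE\<close> also demands uniqueness, that
  is, nondegeneracy of d\<alpha> on the kernel of \<alpha>.\<close>

lemma reeb_field_eq:
  assumes y: "y \<in> unit_sphere"
  shows "reeb_field \<alpha> y = tangent_proj y (cmul_i (ham_grad y))"
proof -
  have y0: "y \<noteq> 0" and sy: "sgn y = y" and ny: "norm y = 1" and yy: "y \<bullet> y = 1"
    using y by (auto simp: sgn_div_norm dot_square_norm)
  define k where "k = 1 / f y"
  have k: "f y * k = 1" "f y * k\<^sup>2 = k" using f_pos[OF y] by (auto simp: k_def power2_eq_square)
  have Dy: "D y \<bullet> y = 0" by (rule D_orthogonal[OF y0])
  define w where "w = tangent_proj y (cmul_i (ham_grad y))"
  define s where "s = y \<bullet> cmul_i (D y)"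
  have sD: "D y \<bullet> cmul_i y = - s" "cmul_i y \<bullet> D y = - s"
    by (simp_all add: s_def inner_commute[of "D y"] inner_cmul_i)
  \<comment> \<open>The last term is the tangential correction; the radial term of
    \<open>ham_grad\<close> contributes the multiple of i y.\<close>
  have w: "w = (2 * k) *\<^sub>R cmul_i y - k\<^sup>2 *\<^sub>R cmul_i (D y) + (k\<^sup>2 * s) *\<^sub>R y"
    by (simp add: w_def tangent_proj_def ham_grad_def sy ny cmul_i_linear_simps inner_diff_right
        s_def k_def power_divide)
  have wy: "y \<bullet> w = 0"
    by (simp add: w inner_add_right inner_diff_right yy s_def)
  have iyw: "cmul_i y \<bullet> w = 2 * k"
    using Dy by (simp add: w inner_add_right inner_diff_right yy inner_commute)
  have iw: "cmul_i w = - (2 * k) *\<^sub>R y + k\<^sup>2 *\<^sub>R D y + (k\<^sup>2 * s) *\<^sub>R cmul_i y"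
    by (simp add: w cmul_i_linear_simps)
  have Dw: "D y \<bullet> w = - 2 * k * s"
    by (simp add: w inner_add_right inner_diff_right sD Dy)
  show ?thesis
    unfolding reeb_field_def w_def[symmetric]
  proof (rule the_equality)
    have ext_w: "sphere_ext_deriv \<alpha> y w v = 0" if "y \<bullet> v = 0" for v
    proof -
      have "sphere_ext_deriv \<alpha> y w v =
        - k * s * (cmul_i y \<bullet> v) - k * (D y \<bullet> v) + f y * (k\<^sup>2 * (D y \<bullet> v) + k\<^sup>2 * s * (cmul_i y \<bullet> v))"
        unfolding sphere_ext_deriv_eq[OF y wy that] Dw iyw iw
        by (simp add: inner_add_left inner_diff_left that)
      also have "\<dots> = - k * s * (cmul_i y \<bullet> v) - k * (D y \<bullet> v) + (f y * k\<^sup>2) * (D y \<bullet> v) + (f y * k\<^sup>2) * s * (cmul_i y \<bullet> v)"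
        by (simp add: algebra_simps)
      finally show ?thesis by (simp add: k(2))
    qed
    have "\<alpha> y w = 1"
      using form[OF y, of w] wy iyw k(1) by (simp add: sphere_tangent_def liouville_eq)
    then show "w \<in> sphere_tangent y \<and> \<alpha> y w = 1 \<and> (\<forall>v\<in>sphere_tangent y. sphere_ext_deriv \<alpha> y w v = 0)"
      using wy ext_w by (auto simp: sphere_tangent_def)
    fix u assume u: "u \<in> sphere_tangent y \<and> \<alpha> y u = 1 \<and> (\<forall>v\<in>sphere_tangent y. sphere_ext_deriv \<alpha> y u v = 0)"
    then have uy: "y \<bullet> u = 0" by (simp add: sphere_tangent_def)
    have iyu: "cmul_i y \<bullet> u = 2 * k"
      using u form[OF y, of u] f_pos[OF y] by (simp add: liouville_eq k_def field_simps)
    define d where "d = u - w"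
    have dy: "y \<bullet> d = 0" "cmul_i y \<bullet> d = 0"
      by (simp_all add: d_def inner_diff_right uy wy iyu iyw)
    have ext: "(D y \<bullet> d) * (cmul_i y \<bullet> v) / 2 + f y * (cmul_i d \<bullet> v) = 0" if v: "y \<bullet> v = 0" for v
    proof -
      have "sphere_ext_deriv \<alpha> y u v = 0" "sphere_ext_deriv \<alpha> y w v = 0"
        using u ext_w[OF v] v by (auto simp: sphere_tangent_def)
      then show ?thesis
        unfolding sphere_ext_deriv_eq[OF y uy v] sphere_ext_deriv_eq[OF y wy v] iyu iyw d_def cmul_i_linear_simps
        by (simp add: inner_diff_left inner_diff_right algebra_simps diff_divide_distrib)
    qed
    \<comment> \<open>Testing with i y removes the term in \<open>D\<close>; testing with i d, which
      is tangent because d is orthogonal to i y, then leaves \<open>f y\<close> times the squared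
      norm of \<open>d\<close>.\<close>
    have "D y \<bullet> d = 0"
      using ext[of "cmul_i y"] by (simp add: yy inner_commute[of d] dy)
    then have "cmul_i d \<bullet> cmul_i d = 0"
      using ext[of "cmul_i d"] dy f_pos[OF y] inner_cmul_i[of y d] by simp
    then show "u = w" by (simp add: d_def)
  qed
qed

end

section \<open>Symmetric closed orbits\<close>

lemma twist_add: "twist (\<lambda>j. a j + b j) v = twist a (twist b v)"
  by (simp add: twist_def vec_eq_iff distrib_left flip: cis_mult)

lemma twist_zero: "twist (\<lambda>j. 0) v = v"
  by (simp add: twist_def vec_eq_iff)

lemma twist_cmul_i: "twist \<theta> (cmul_i v) = cmul_i (twist \<theta> v)"
  by (simp add: twist_def cmul_i_def vec_eq_iff)

lemma inner_twist_twist [simp]: "twist \<theta> u \<bullet> twist \<theta> v = u \<bullet> v"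
proof -
  have "(cis a * x) \<bullet> (cis a * y) = x \<bullet> y" for a x y
  proof -
    have "(cis a * x) \<bullet> (cis a * y) = Re ((cis a * cnj (cis a)) * (x * cnj y))"
      by (simp add: inner_complex_def algebra_simps)
    then show ?thesis by (simp add: cis_cnj cis_mult inner_complex_def)
  qed
  then show ?thesis by (simp add: inner_vec_def twist_def)
qed

lemma sgn_twist: "sgn (twist \<theta> z) = twist \<theta> (sgn z)"
  by (simp add: sgn_div_norm linear_scale[OF linear_twist])

lemma lens_rotation_eq_twist: "lens_rotation p l = twist (\<lambda>j. of_int (l j) / of_nat p)"
  by (simp add: fun_eq_iff lens_rotation_def twist_def vec_eq_iff cis_conv_exp mult_ac)

lemma funpow_twist: "(twist \<theta> ^^ k) v = twist (\<lambda>j. of_nat k * \<theta> j) v"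
proof (induction k)
  case (Suc k)
  have "(\<lambda>j. of_nat (Suc k) * \<theta> j) = (\<lambda>j. \<theta> j + of_nat k * \<theta> j)"
    by (simp add: distrib_right fun_eq_iff)
  then show ?case by (simp add: Suc twist_add)
qed (simp add: twist_zero)

lemma funpow_lens_rotation_period:
  assumes "p \<ge> 1"
  shows "(lens_rotation p l ^^ p) v = v"
proof -
  have "cis (2 * pi * of_int k) = 1" for k
    using cis_multiple_2pi[of "of_int k"] by simp
  then show ?thesis
    using assms by (simp add: lens_rotation_eq_twist funpow_twist twist_def vec_eq_iff)
qed

locale symmetric_contact_sphere = contact_sphere \<alpha> f D
  for \<alpha> :: "complex ^ 'n::finite \<Rightarrow> complex ^ 'n \<Rightarrow> real" and f D +
  fixes \<theta> :: "'n \<Rightarrow> real"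
  assumes invariant: "x \<in> unit_sphere \<Longrightarrow> f (twist \<theta> x) = f x"
begin

definition rot where "rot m = twist (\<lambda>j. of_int m * \<theta> j)"

lemma rot_zero [simp]: "rot 0 v = v"
  by (simp add: rot_def twist_zero)

lemma rot_one: "rot 1 = twist \<theta>"
  by (simp add: rot_def)

lemma rot_add: "rot (m + n) v = rot m (rot n v)"
  by (simp add: rot_def distrib_right twist_add)

lemma ham_twist: "ham (twist \<theta> z) = ham z"
proof (cases "z = 0")
  case True
  then show ?thesis by (simp add: ham_def)
next
  case False
  then show ?thesis using invariant[OF sgn_in_sphere[OF False]] by (simp add: ham_def sgn_twist)
qed

lemma ham_rot: "ham (rot m z) = ham z"
proof (induction m rule: int_induct[where k = 0])
  case (step1 i)
  have "rot (i + 1) z = twist \<theta> (rot i z)"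
    using rot_add[of 1 i z] by (simp add: rot_one add.commute)
  then show ?case using step1 by (simp add: ham_twist)
next
  case (step2 i)
  have "rot i z = twist \<theta> (rot (i - 1) z)"
    using rot_add[of 1 "i - 1" z] by (simp add: rot_one)
  then show ?case using step2 by (simp add: ham_twist)
qed simp

text \<open>The gradient of a function invariant under an isometry is equivariant. Invertibility of
  \<open>rot m\<close> lets the test vector be arbitrary.\<close>

lemma ham_grad_rot: "ham_grad (rot m z) = rot m (ham_grad z)"
proof -
  have "(rot m has_derivative rot m) (at z)"
    unfolding rot_def
    by (rule bounded_linear_imp_has_derivative[OF linear_twist[unfolded linear_conv_bounded_linear]])
  from has_derivative_compose[OF this deriv]
  have "((\<lambda>z. ham (rot m z)) has_derivative (\<lambda>h. ham_grad (rot m z) \<bullet> rot m h)) (at z)" .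
  then have "(\<lambda>h. ham_grad (rot m z) \<bullet> rot m h) = (\<lambda>h. ham_grad z \<bullet> h)"
    unfolding ham_rot by (rule has_derivative_unique[OF _ deriv])
  then have *: "ham_grad (rot m z) \<bullet> rot m h = rot m (ham_grad z) \<bullet> rot m h" for h
    by (metis rot_def inner_twist_twist)
  have "rot m (rot (- m) v) = v" for v
    using rot_add[of m "- m" v] by simp
  then have "ham_grad (rot m z) \<bullet> v = rot m (ham_grad z) \<bullet> v" for v
    using *[of "rot (- m) v"] by simp
  then show ?thesis by (metis vector_eq_rdot)
qed

lemma twisted_reeb_orbit_exists:
  assumes "0 < w" and "\<And>i. 0 < twisted_freq \<theta> i \<Longrightarrow> w \<le> twisted_freq \<theta> i"
  obtains \<gamma> \<tau> where "0 < \<tau>" "\<And>t. \<gamma> t \<in> unit_sphere"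
    "\<And>t. (\<gamma> has_vector_derivative reeb_field \<alpha> (\<gamma> t)) (at t)" "\<And>t. \<gamma> (t + \<tau>) = twist \<theta> (\<gamma> t)"
proof -
  interpret twisted_hamiltonian ham ham_grad \<theta> w
    by unfold_locales (rule assms(1), erule assms(2))
  obtain x \<tau> where x: "0 < \<tau>" "x 1 = twist \<theta> (x 0)" "\<And>t. t \<in> {0..1} \<Longrightarrow> x t \<noteq> 0"
    "\<And>t. t \<in> {0..1} \<Longrightarrow> (x has_vector_derivative \<tau> *\<^sub>R cmul_i (ham_grad (x t))) (at t within {0..1})"
    by (rule orbit_segment_exists) blast
  define X where "X t = rot \<lfloor>t\<rfloor> (x (frac t))" for t
  have dX: "(X has_vector_derivative \<tau> *\<^sub>R cmul_i (ham_grad (X t))) (at t)" for t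
    unfolding X_def[abs_def]
  proof (rule equivariant_continuation[where F = "\<lambda>v. \<tau> *\<^sub>R cmul_i (ham_grad v)" and R = rot])
    show "linear (rot m)" for m unfolding rot_def by (rule linear_twist)
    show "rot (m + 1) v = rot m (rot 1 v)" for m v by (rule rot_add)
    show "\<tau> *\<^sub>R cmul_i (ham_grad (rot m v)) = rot m (\<tau> *\<^sub>R cmul_i (ham_grad v))" for m v
      unfolding ham_grad_rot unfolding rot_def by (simp add: linear_scale[OF linear_twist] twist_cmul_i)
    show "rot 0 v = v" for v by simp
    show "x 1 = rot 1 (x 0)" by (simp add: rot_one x(2))
  qed (rule x(4))
  have X0: "X t \<noteq> 0" for t
  proof -
    have "norm (X t) = norm (x (frac t))" by (simp add: X_def rot_def)
    moreover have "x (frac t) \<noteq> 0" using frac_lt_1[of t] by (intro x(3)) (simp add: less_imp_le)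
    ultimately show ?thesis by auto
  qed
  have X1: "X (t + 1) = twist \<theta> (X t)" for t
    using rot_add[of 1 "\<lfloor>t\<rfloor>"] by (simp add: X_def rot_one add.commute frac_def)
  \<comment> \<open>Rescaling time absorbs the factor \<tau> of the equation, so the unit shift of
    \<open>X\<close> becomes a shift of \<gamma> by \<tau>.\<close>
  define \<gamma> where "\<gamma> t = sgn (X (t / \<tau>))" for t
  show ?thesis
  proof (rule that[OF x(1)])
    show \<gamma>: "\<gamma> t \<in> unit_sphere" for t
      unfolding \<gamma>_def by (rule sgn_in_sphere[OF X0])
    show "\<gamma> (t + \<tau>) = twist \<theta> (\<gamma> t)" for t
      using x(1) by (simp add: \<gamma>_def add_divide_distrib X1 sgn_twist)
    fix t
    let ?z = "X (t / \<tau>)"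
    have "((\<lambda>s. s / \<tau>) has_derivative (\<lambda>h. h / \<tau>)) (at t)"
      using x(1) by (auto intro!: derivative_eq_intros)
    from has_derivative_compose[OF this dX[unfolded has_vector_derivative_def]]
    have "((\<lambda>s. X (s / \<tau>)) has_derivative (\<lambda>h. h *\<^sub>R cmul_i (ham_grad ?z))) (at t)"
      using x(1) by simp
    from has_derivative_compose[OF this has_derivative_sgn[OF X0]]
    have "(\<gamma> has_derivative (\<lambda>h. (1 / norm ?z) *\<^sub>R tangent_proj (\<gamma> t) (h *\<^sub>R cmul_i (ham_grad ?z)))) (at t)"
      by (simp add: \<gamma>_def[abs_def] tangent_proj_def)
    moreover have "(1 / norm ?z) *\<^sub>R tangent_proj (\<gamma> t) (h *\<^sub>R cmul_i (ham_grad ?z)) = h *\<^sub>R reeb_field \<alpha> (\<gamma> t)" for h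
    proof -
      \<comment> \<open>Homogeneity of degree 1 cancels the factor \<open>1 / norm ?z\<close> from
        the derivative of \<open>sgn\<close>, so the projected curve has exactly the Reeb
        speed.\<close>
      have "ham_grad ?z = ham_grad (norm ?z *\<^sub>R \<gamma> t)"
        using X0 by (simp add: \<gamma>_def sgn_div_norm)
      also have "\<dots> = norm ?z *\<^sub>R ham_grad (\<gamma> t)"
        by (rule ham_grad_scale) (simp add: X0)
      finally show ?thesis
        using X0 by (simp add: reeb_field_eq[OF \<gamma>] tangent_proj_linear_simps cmul_i_linear_simps)
    qed
    ultimately show "(\<gamma> has_vector_derivative reeb_field \<alpha> (\<gamma> t)) (at t)"
      by (simp add: has_vector_derivative_def)
  qed
qed

end

theorem theorem1p1:
  fixes p :: nat and l :: "'n::finite \<Rightarrow> int"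
    and \<alpha> :: "complex ^ 'n \<Rightarrow> complex ^ 'n \<Rightarrow> real"
  assumes "p \<ge> 1"
    and "\<And>i. coprime (l i) (int p)"
    and "contact_form_sphere \<alpha>"
    and "\<forall>x\<in>unit_sphere. \<forall>v\<in>sphere_tangent x. pullback_form (lens_rotation p l) \<alpha> x v = \<alpha> x v"
  shows "\<exists>\<gamma>. closed_reeb_orbit \<alpha> \<gamma> \<and> (\<forall>g\<in>lens_group p l. g ` range \<gamma> = range \<gamma>)"
proof -
  define \<psi> where "\<psi> = lens_rotation p l"
  define \<theta> where "\<theta> j = of_int (l j) / real p" for j
  have \<psi>: "\<psi> = twist \<theta>" by (simp add: \<psi>_def \<theta>_def[abs_def] lens_rotation_eq_twist)
  obtain f where f: "smooth_on_subset f unit_sphere" "\<And>x. x \<in> unit_sphere \<Longrightarrow> 0 < f x"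
    "\<And>x v. x \<in> unit_sphere \<Longrightarrow> v \<in> sphere_tangent x \<Longrightarrow> \<alpha> x v = f x * liouville x v"
    using assms(3) unfolding contact_form_sphere_def by blast
  obtain D where D: "\<And>z. z \<noteq> 0 \<Longrightarrow> ((\<lambda>z. f (sgn z)) has_derivative (\<lambda>h. D z \<bullet> h)) (at z)"
    "continuous_on (- {0}) D"
    using smooth_on_sphere_gradient[OF f(1)] by metis
  \<comment> \<open>Evaluate the invariance of \<alpha> on the vector i x: \<psi> is complex linear
    and maps it to i \<psi>(x), and the Liouville form equals 1/2 on such vectors, so only the
    factors \<open>f\<close> remain.\<close>
  have inv: "f (twist \<theta> x) = f x" if x: "x \<in> unit_sphere" for x
  proof -
    have "(\<psi> has_derivative \<psi>) (at x)"
      unfolding \<psi>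
      by (rule bounded_linear_imp_has_derivative[OF linear_twist[unfolded linear_conv_bounded_linear]])
    then have fd: "frechet_derivative \<psi> (at x) = \<psi>"
      by (rule frechet_derivative_at[symmetric])
    have v: "cmul_i x \<in> sphere_tangent x" by (simp add: sphere_tangent_def)
    have "\<alpha> (\<psi> x) (\<psi> (cmul_i x)) = \<alpha> x (cmul_i x)"
      using assms(4) x v fd unfolding pullback_form_def \<psi>_def by metis
    moreover have "\<psi> (cmul_i x) = cmul_i (\<psi> x)" by (simp add: \<psi> twist_cmul_i)
    moreover have \<psi>x: "\<psi> x \<in> unit_sphere" using x by (simp add: \<psi>)
    moreover have "cmul_i (\<psi> x) \<in> sphere_tangent (\<psi> x)" by (simp add: sphere_tangent_def)
    ultimately have E: "f (\<psi> x) * liouville (\<psi> x) (cmul_i (\<psi> x)) = f x * liouville x (cmul_i x)"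
      using f(3)[OF x v] f(3)[of "\<psi> x" "cmul_i (\<psi> x)"] by metis
    have ly: "liouville y (cmul_i y) = 1 / 2" if "y \<in> unit_sphere" for y :: "complex ^ 'n"
      using that by (simp add: liouville_eq dot_square_norm)
    from E have "f (\<psi> x) * (1 / 2) = f x * (1 / 2)" by (simp only: ly[OF x] ly[OF \<psi>x])
    then show ?thesis by (simp add: \<psi>)
  qed
  interpret symmetric_contact_sphere \<alpha> f D \<theta>
    by unfold_locales (erule f(2), erule (1) f(3), erule D(1), rule D(2), erule inv)
  \<comment> \<open>For these angles every frequency is an integer multiple of 2 pi / p.\<close>
  have gap: "2 * pi / p \<le> twisted_freq \<theta> i" if pos: "0 < twisted_freq \<theta> i" for i
  proof -
    obtain j k b where i: "i = (j, k, b)" by (cases i)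
    have eq: "twisted_freq \<theta> i = (2 * pi / p) * of_int (k * int p + l j)"
      using assms(1) by (simp add: i twisted_freq_def \<theta>_def field_simps)
    then have "0 < real_of_int (k * int p + l j)"
      using pos assms(1) by (simp add: zero_less_mult_iff zero_less_divide_iff)
    then have "0 < k * int p + l j" by (simp only: of_int_0_less_iff)
    then have "1 \<le> real_of_int (k * int p + l j)" by (simp only: of_int_1_le_iff)
    then have "(2 * pi / p) * 1 \<le> (2 * pi / p) * real_of_int (k * int p + l j)"
      by (intro mult_left_mono) auto
    then show ?thesis unfolding eq by simp
  qed
  have "0 < 2 * pi / p" using assms(1) by simp
  then obtain \<gamma> \<tau> where \<gamma>: "0 < \<tau>" "\<And>t. \<gamma> t \<in> unit_sphere"
    "\<And>t. (\<gamma> has_vector_derivative reeb_field \<alpha> (\<gamma> t)) (at t)" "\<And>t. \<gamma> (t + \<tau>) = twist \<theta> (\<gamma> t)"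
    using twisted_reeb_orbit_exists gap by metis
  \<comment> \<open>Powers of \<psi> act on the orbit as time shifts. Since the p-th power is the
    identity, the orbit closes after time p \<tau>; since a shift maps the time line onto itself,
    its image is invariant.\<close>
  have iter: "\<gamma> (t + of_nat k * \<tau>) = (\<psi> ^^ k) (\<gamma> t)" for t k
  proof (induction k)
    case (Suc k)
    have "\<gamma> (t + of_nat (Suc k) * \<tau>) = \<gamma> ((t + of_nat k * \<tau>) + \<tau>)" by (simp add: algebra_simps)
    then show ?case by (simp add: \<gamma>(4) Suc \<psi>)
  qed simp
  have "closed_reeb_orbit \<alpha> \<gamma>"
    unfolding closed_reeb_orbit_def
  proof (intro conjI allI)
    have "\<gamma> (t + of_nat p * \<tau>) = \<gamma> t" for t
      unfolding iter \<psi>_def by (rule funpow_lens_rotation_period[OF assms(1)])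
    then show "\<exists>T>0. \<forall>t. \<gamma> (t + T) = \<gamma> t"
      using \<gamma>(1) assms(1) by (intro exI[of _ "of_nat p * \<tau>"]) simp
  qed (use \<gamma> in auto)
  moreover have "g ` range \<gamma> = range \<gamma>" if g: "g \<in> lens_group p l" for g
  proof -
    obtain k where k: "g = \<psi> ^^ k" using g by (auto simp: lens_group_def \<psi>_def)
    have "g ` range \<gamma> = \<gamma> ` range (\<lambda>t. t + of_nat k * \<tau>)"
      by (simp only: k image_image iter)
    also have "range (\<lambda>t. t + of_nat k * \<tau>) = UNIV"
      by (rule surjI[where f = "\<lambda>t. t - of_nat k * \<tau>"]) simp
    finally show ?thesis .
  qed
  ultimately show ?thesis by blast
qed

end
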